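(* The problem of deciding, given two consistent conjunctions of literals $K_1,K_2$ and a consistent formula $R$ that is Horn or Krom, whether $R$ is obtainable from $\{K_1,K_2\}$ by the weighted sum of the Hamming distances is in P (solvable in polynomial time).
   Context: A Horn formula is a CNF in which every clause has at most one positive literal; a Krom formula is a CNF in which every clause has at most two literals. The Hamming distance $d(I,J)$ between two interpretations over the same finite set of variables is the number of variables they evaluate differently. For a consistent formula $K$, $d(I,K)=\min\{d(I,J) : J\models K\}$. Given positive integer weights $w_1,w_2$, the weighted distance of $I$ is $w_1 d(I,K_1)+w_2 d(I,K_2)$, and the result of merging $K_1,K_2$ with these weights is the formula (up to equivalence) whose models are exactly the interpretations of minimal weighted distance. $R$ is obtainable from $\{K_1,K_2\}$ if there exist positive integers $w_1,w_2$ such that $R$ is equivalent to the result of merging $K_1,K_2$ with weights $w_1,w_2$. *)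

theory Defs
  imports Main "HOL-Computational_Algebra.Polynomial"
begin

section \<open>Formulas and interpretations\<close>

datatype 'v literal = Pos 'v | Neg 'v

text \<open>Lists of literals are used both for clauses (disjunctions) and for conjunctions of literals.
  Order and repetitions are immaterial: all notions below depend only on the set of literals.\<close>

type_synonym 'v cnf = "'v literal list list"

primrec lit_var :: "'v literal \<Rightarrow> 'v" where
  "lit_var (Pos v) = v"
| "lit_var (Neg v) = v"

primrec lit_true :: "('v \<Rightarrow> bool) \<Rightarrow> 'v literal \<Rightarrow> bool" where
  "lit_true I (Pos v) \<longleftrightarrow> I v"
| "lit_true I (Neg v) \<longleftrightarrow> \<not> I v"

definition models_conj :: "'v literal list \<Rightarrow> ('v \<Rightarrow> bool) set" where
  "models_conj K = {I. \<forall>l \<in> set K. lit_true I l}"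

definition models_cnf :: "'v cnf \<Rightarrow> ('v \<Rightarrow> bool) set" where
  "models_cnf F = {I. \<forall>C \<in> set F. \<exists>l \<in> set C. lit_true I l}"

definition vars_conj :: "'v literal list \<Rightarrow> 'v set" where
  "vars_conj K = lit_var ` set K"

definition vars_cnf :: "'v cnf \<Rightarrow> 'v set" where
  "vars_cnf F = (\<Union>C \<in> set F. lit_var ` set C)"

definition horn :: "'v cnf \<Rightarrow> bool" where
  "horn F \<longleftrightarrow> (\<forall>C \<in> set F. card {v. Pos v \<in> set C} \<le> 1)"

definition krom :: "'v cnf \<Rightarrow> bool" where
  "krom F \<longleftrightarrow> (\<forall>C \<in> set F. card (set C) \<le> 2)"


section \<open>Merging by the weighted sum of the Hamming distances\<close>

text \<open>An interpretation over the finite set of variables \<open>X\<close> is represented by a total function,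
  whose values outside \<open>X\<close> are irrelevant. A formula enters only through its set of models \<open>M\<close>.\<close>

definition hamming :: "'v set \<Rightarrow> ('v \<Rightarrow> bool) \<Rightarrow> ('v \<Rightarrow> bool) \<Rightarrow> nat" where
  "hamming X I J = card {x \<in> X. I x \<noteq> J x}"

definition hamming_models :: "'v set \<Rightarrow> ('v \<Rightarrow> bool) \<Rightarrow> ('v \<Rightarrow> bool) set \<Rightarrow> nat" where
  "hamming_models X I M = Min {hamming X I J | J. J \<in> M}"

definition weighted_dist ::
  "'v set \<Rightarrow> nat \<Rightarrow> nat \<Rightarrow> ('v \<Rightarrow> bool) set \<Rightarrow> ('v \<Rightarrow> bool) set \<Rightarrow> ('v \<Rightarrow> bool) \<Rightarrow> nat" where
  "weighted_dist X w1 w2 M1 M2 I = w1 * hamming_models X I M1 + w2 * hamming_models X I M2"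

definition merge_models ::
  "'v set \<Rightarrow> nat \<Rightarrow> nat \<Rightarrow> ('v \<Rightarrow> bool) set \<Rightarrow> ('v \<Rightarrow> bool) set \<Rightarrow> ('v \<Rightarrow> bool) set" where
  "merge_models X w1 w2 M1 M2 =
     {I. \<forall>J. weighted_dist X w1 w2 M1 M2 I \<le> weighted_dist X w1 w2 M1 M2 J}"

definition obtainable :: "'v literal list \<Rightarrow> 'v literal list \<Rightarrow> 'v cnf \<Rightarrow> bool" where
  "obtainable K1 K2 R \<longleftrightarrow>
     (\<exists>w1 w2. w1 > 0 \<and> w2 > 0 \<and>
        models_cnf R = merge_models (vars_conj K1 \<union> vars_conj K2 \<union> vars_cnf R) w1 w2
                         (models_conj K1) (models_conj K2))"


section \<open>Deterministic multi-tape Turing machines and the class P\<close>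

datatype move = Move_Left | Move_Stay | Move_Right

text \<open>States are \<open>0\<close> (initial), \<open>1\<close> (accepting), \<open>2\<close> (rejecting) and
  further numbers below \<open>tm_states\<close>; the symbol \<open>0\<close> is the blank. Only the finitely many
  values of \<open>tm_delta\<close> constrained by \<open>wf_tm\<close> below affect a computation.\<close>

record tm =
  tm_tapes :: nat
  tm_symbols :: nat
  tm_states :: nat
  tm_delta :: "nat \<Rightarrow> nat list \<Rightarrow> nat \<times> (nat \<times> move) list"

definition halting :: "nat \<Rightarrow> bool" where
  "halting q \<longleftrightarrow> q = 1 \<or> q = 2"

definition wf_tm :: "tm \<Rightarrow> bool" where
  "wf_tm M \<longleftrightarrow> tm_tapes M \<ge> 1 \<and> tm_symbols M \<ge> 3 \<and> tm_states M \<ge> 3 \<and>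
     (\<forall>q rs. q < tm_states M \<and> \<not> halting q \<and> length rs = tm_tapes M \<and> set rs \<subseteq> {..<tm_symbols M} \<longrightarrow>
        (case tm_delta M q rs of (q', acts) \<Rightarrow>
           q' < tm_states M \<and> length acts = tm_tapes M \<and> fst ` set acts \<subseteq> {..<tm_symbols M}))"

text \<open>A tape is two-way infinite and given by its contents and the position of the head.\<close>

type_synonym tape = "(int \<Rightarrow> nat) \<times> int"

definition tape_read :: "tape \<Rightarrow> nat" where
  "tape_read t = fst t (snd t)"

primrec move_offset :: "move \<Rightarrow> int" where
  "move_offset Move_Left = -1"
| "move_offset Move_Stay = 0"
| "move_offset Move_Right = 1"

definition tape_act :: "nat \<times> move \<Rightarrow> tape \<Rightarrow> tape" where
  "tape_act a t = ((fst t)(snd t := fst a), snd t + move_offset (snd a))"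

type_synonym config = "nat \<times> tape list"

definition tm_step :: "tm \<Rightarrow> config \<Rightarrow> config" where
  "tm_step M c =
     (case c of (q, ts) \<Rightarrow>
        if halting q then (q, ts)
        else (case tm_delta M q (map tape_read ts) of (q', acts) \<Rightarrow> (q', map2 tape_act acts ts)))"

text \<open>The input word is written on the first tape from position \<open>0\<close> on, with \<open>1\<close> for
  \<^const>\<open>False\<close> and \<open>2\<close> for \<^const>\<open>True\<close>; the other tapes are blank.\<close>

definition input_tape :: "bool list \<Rightarrow> tape" where
  "input_tape x =
     ((\<lambda>i. if 0 \<le> i \<and> i < int (length x) then (if x ! nat i then 2 else 1) else 0), 0)"

definition blank_tape :: tape where
  "blank_tape = ((\<lambda>_. 0), 0)"

definition tm_init :: "tm \<Rightarrow> bool list \<Rightarrow> config" where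
  "tm_init M x = (0, input_tape x # replicate (tm_tapes M - 1) blank_tape)"

definition tm_run :: "tm \<Rightarrow> nat \<Rightarrow> bool list \<Rightarrow> config" where
  "tm_run M t x = (tm_step M ^^ t) (tm_init M x)"

text \<open>Halting configurations are fixed points of \<^const>\<open>tm_step\<close>, so inspecting the state after
  exactly \<open>T (length x)\<close> steps amounts to halting within that many steps.\<close>

definition decides_in_time :: "tm \<Rightarrow> bool list set \<Rightarrow> (nat \<Rightarrow> nat) \<Rightarrow> bool" where
  "decides_in_time M L T \<longleftrightarrow>
     (\<forall>x. fst (tm_run M (T (length x)) x) = (if x \<in> L then 1 else 2))"

definition class_P :: "bool list set set" where
  "class_P = {L. \<exists>M (p :: nat poly). wf_tm M \<and> decides_in_time M L (\<lambda>n. poly p n)}"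


section \<open>The decision problem as a language\<close>

text \<open>In problem instances a variable is identified by its name, an arbitrary finite binary word.
  An instance is written as a word over four tokens, each coded by two bits. A literal is its sign
  followed by the variable name and a comma; a list of literals is closed by a semicolon.\<close>

type_synonym var = "bool list"

datatype token = Bit bool | Comma | Semicolon

primrec token_bits :: "token \<Rightarrow> bool list" where
  "token_bits (Bit b) = [False, b]"
| "token_bits Comma = [True, False]"
| "token_bits Semicolon = [True, True]"

primrec literal_tokens :: "var literal \<Rightarrow> token list" where
  "literal_tokens (Pos v) = Bit True # map Bit v @ [Comma]"
| "literal_tokens (Neg v) = Bit False # map Bit v @ [Comma]"

definition literals_tokens :: "var literal list \<Rightarrow> token list" where
  "literals_tokens ls = concat (map literal_tokens ls) @ [Semicolon]"

definition encode :: "var literal list \<Rightarrow> var literal list \<Rightarrow> var cnf \<Rightarrow> bool list" where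
  "encode K1 K2 R = concat (map token_bits (concat (map literals_tokens (K1 # K2 # R))))"

definition obtainability_problem :: "bool list set" where
  "obtainability_problem =
     {encode K1 K2 R | K1 K2 R.
        models_conj K1 \<noteq> {} \<and> models_conj K2 \<noteq> {} \<and> models_cnf R \<noteq> {} \<and>
        (horn R \<or> krom R) \<and> obtainable K1 K2 R}"


subsection \<open>Instances are uniquely encoded\<close>

lemma token_bits_inject:
  "concat (map token_bits xs) = concat (map token_bits ys) \<Longrightarrow> xs = ys"
proof (induction xs arbitrary: ys)
  case Nil
  then show ?case by (cases ys; cases "hd ys") auto
next
  case (Cons x xs)
  then obtain y ys' where ys: "ys = y # ys'" by (cases ys; cases x) auto
  with Cons show ?case by (cases x; cases y) auto
qed

lemma map_Bit_Comma_inject: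
  "map Bit v @ Comma # r = map Bit w @ Comma # s \<Longrightarrow> v = w \<and> r = s"
proof (induction v arbitrary: w)
  case Nil
  then show ?case by (cases w) auto
next
  case (Cons b v)
  then show ?case by (cases w) auto
qed

lemma literal_tokens_inject:
  "literal_tokens l @ r = literal_tokens m @ s \<Longrightarrow> l = m \<and> r = s"
  by (cases l; cases m) (auto dest: map_Bit_Comma_inject)

lemma literals_tokens_inject:
  "literals_tokens ls @ r = literals_tokens ms @ s \<Longrightarrow> ls = ms \<and> r = s"
proof (induction ls arbitrary: ms)
  case Nil
  then show ?case by (cases ms; cases "hd ms") (auto simp: literals_tokens_def)
next
  case (Cons l ls)
  then obtain m ms' where ms: "ms = m # ms'"
    by (cases ms; cases l) (auto simp: literals_tokens_def)
  with Cons.prems have "literal_tokens l @ (literals_tokens ls @ r) =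
      literal_tokens m @ (literals_tokens ms' @ s)"
    by (simp add: literals_tokens_def)
  then have "l = m" "literals_tokens ls @ r = literals_tokens ms' @ s"
    using literal_tokens_inject by blast+
  with Cons.IH ms show ?case by blast
qed

lemma concat_literals_tokens_inject:
  "concat (map literals_tokens F) = concat (map literals_tokens G) \<Longrightarrow> F = G"
proof (induction F arbitrary: G)
  case Nil
  then show ?case by (cases G) (auto simp: literals_tokens_def)
next
  case (Cons C F)
  then obtain D G' where G: "G = D # G'" by (cases G) (auto simp: literals_tokens_def)
  with Cons.prems literals_tokens_inject have
    "C = D" "concat (map literals_tokens F) = concat (map literals_tokens G')" by auto
  with Cons.IH G show ?case by blast
qed

lemma encode_inject: "encode K1 K2 R = encode K1' K2' R' \<longleftrightarrow> K1 = K1' \<and> K2 = K2' \<and> R = R'"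
  unfolding encode_def by (auto dest!: token_bits_inject concat_literals_tokens_inject
    simp del: map_concat list.map concat.simps)

end

theory Submission
  imports Defs
begin

text \<open>The weighted distance is a sum of costs of the single variables, so an interpretation is minimal
  iff it is minimal at each variable, and the outcome depends only on whether \<open>w1\<close> is greater than,
  less than or equal to \<open>w2\<close>. The result of merging is therefore one of three conjunctions of literals.
  Whether such a conjunction \<open>L\<close> entails \<open>R\<close> is checked clause by clause. Whether a consistent Horn or
  Krom formula \<open>R\<close> entails a literal of \<open>L\<close> is checked by unit propagation from the complement, which
  finds a conflict whenever there is one.

  For the time bound, Turing machines are programmed as stack machines, one stack per tape. Values are
  binary trees, held on a stack in prefix notation, and the functions computable in polynomial time
  on them are closed under composition, pairing, case distinction and folds whose accumulator
  grows by a polynomial amount in each step. The decision procedure is a composition of these.\<close>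

section \<open>Stack programs on Turing machines\<close>

text \<open>\<open>class_P\<close> is defined by concrete machines and comes with no closure
  properties, so the bulk of the work is a small compiler whose correctness statements carry time
  bounds. Prefix codes of trees delimit themselves: a program finds the end of its argument without
  knowing what lies below it, and needs no named registers. Stack 0 holds argument and result,
  stacks 1 and 2 are scratch space. Since all types share the same trees, each closure property is
  proved once, polymorphically, and the decision procedure is then shown to be polynomial by
  following the structure of its defining terms. Iteration is always clocked by the length of a
  list, which is why unit propagation runs a fixed number of rounds even if nothing new is
  derived.\<close>

datatype com =
    Push nat nat
  | Pop nat
  | Copy nat nat
  | Seq com com (infixr \<open>;;\<close> 60)
  | Cond nat "nat \<Rightarrow> bool" com com
  | Loop nat "nat \<Rightarrow> bool" com

text \<open>One state per machine step. A step writes before it moves, whereas a push has to move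
  left before it writes, hence 2 for \<open>Push\<close> and \<open>Copy\<close>. The 2 added for
  \<open>Cond\<close> and \<open>Loop\<close> are the test and the jump after the first branch or
  the body.\<close>

primrec code_len :: "com \<Rightarrow> nat" where
  "code_len (Push r a) = 2"
| "code_len (Pop r) = 1"
| "code_len (Copy r r') = 2"
| "code_len (c ;; d) = code_len c + code_len d"
| "code_len (Cond r P c d) = code_len c + code_len d + 2"
| "code_len (Loop r P c) = code_len c + 2"

definition stay :: "nat list \<Rightarrow> (nat \<times> move) list" where
  "stay rs = map (\<lambda>a. (a, Move_Stay)) rs"

text \<open>A program loaded at state \<open>n\<close> fills \<open>code_len c\<close> consecutive
  states and is left through the state after them, so sequencing is juxtaposition. A test sees one
  symbol only, so an arbitrary predicate costs a single step.\<close>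

primrec code :: "com \<Rightarrow> nat \<Rightarrow> nat \<Rightarrow> nat list \<Rightarrow> nat \<times> (nat \<times> move) list" where
  "code (Push r a) n q rs =
     (if q = n then (n + 1, (stay rs)[r := (rs ! r, Move_Left)])
      else (n + 2, (stay rs)[r := (a, Move_Stay)]))"
| "code (Pop r) n q rs = (n + 1, (stay rs)[r := (rs ! r, Move_Right)])"
| "code (Copy r r') n q rs =
     (if q = n then (n + 1, (stay rs)[r' := (rs ! r', Move_Left)])
      else (n + 2, (stay rs)[r' := (rs ! r, Move_Stay)]))"
| "code (c ;; d) n q rs =
     (if q < n + code_len c then code c n q rs else code d (n + code_len c) q rs)"
| "code (Cond r P c d) n q rs =
     (if q = n then (if P (rs ! r) then n + 1 else n + 2 + code_len c, stay rs)
      else if q < n + 1 + code_len c then code c (n + 1) q rs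
      else if q = n + 1 + code_len c then (n + 2 + code_len c + code_len d, stay rs)
      else code d (n + 2 + code_len c) q rs)"
| "code (Loop r P c) n q rs =
     (if q = n then (if P (rs ! r) then n + 1 else n + 2 + code_len c, stay rs)
      else if q < n + 1 + code_len c then code c (n + 1) q rs
      else (n, stay rs))"

text \<open>Three tapes; the four symbols are the blank 0, the tree symbols 1 and 2, and the marker
  3.\<close>

primrec wf_com :: "com \<Rightarrow> bool" where
  "wf_com (Push r a) \<longleftrightarrow> r < 3 \<and> a < 4"
| "wf_com (Pop r) \<longleftrightarrow> r < 3"
| "wf_com (Copy r r') \<longleftrightarrow> r < 3 \<and> r' < 3"
| "wf_com (c ;; d) \<longleftrightarrow> wf_com c \<and> wf_com d"
| "wf_com (Cond r P c d) \<longleftrightarrow> r < 3 \<and> wf_com c \<and> wf_com d"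
| "wf_com (Loop r P c) \<longleftrightarrow> r < 3 \<and> wf_com c"

lemma stay_upd_symbols:
  assumes "set rs \<subseteq> {..<4}" "a < 4"
  shows "fst ` set ((stay rs)[r := (a, m)]) \<subseteq> {..<4}"
  using assms set_update_subset_insert[of "stay rs" r "(a, m)"] by (fastforce simp: stay_def)

lemma stay_symbols: "set rs \<subseteq> {..<4} \<Longrightarrow> fst ` set (stay rs) \<subseteq> {..<4}"
  by (auto simp: stay_def)

lemma length_stay [simp]: "length (stay rs) = length rs"
  by (simp add: stay_def)

text \<open>The bound on the next state is not strict because \<open>n + code_len c\<close> is the
  exit state of the block.\<close>

lemma code_wf:
  assumes "wf_com c" "n \<le> q" "q < n + code_len c" "length rs = 3" "set rs \<subseteq> {..<4}"
  shows "fst (code c n q rs) \<le> n + code_len c \<and> length (snd (code c n q rs)) = 3 \<and>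
    fst ` set (snd (code c n q rs)) \<subseteq> {..<4}"
  using assms
proof (induction c arbitrary: n)
  case (Push r a)
  then have "rs ! r < 4" by (auto simp: subset_iff)
  with Push show ?case using stay_upd_symbols[of rs] by simp
next
  case (Pop r)
  then have "rs ! r < 4" by (auto simp: subset_iff)
  with Pop show ?case using stay_upd_symbols[of rs] by simp
next
  case (Copy r r')
  then have "rs ! r < 4" "rs ! r' < 4" by (auto simp: subset_iff)
  with Copy show ?case using stay_upd_symbols[of rs] by simp
next
  case (Seq c d)
  show ?case
  proof (cases "q < n + code_len c")
    case True
    then show ?thesis using Seq.IH(1)[of n] Seq.prems by auto
  next
    case False
    then show ?thesis using Seq.IH(2)[of "n + code_len c"] Seq.prems by auto
  qed
next
  case (Cond r P c d)
  consider "q = n \<or> q = n + 1 + code_len c" | "q \<noteq> n" "q < n + 1 + code_len c" | "q > n + 1 + code_len c"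
    by linarith
  then show ?case
  proof cases
    case 1
    then show ?thesis using Cond.prems stay_symbols[of rs] by auto
  next
    case 2
    then show ?thesis using Cond.IH(1)[of "n + 1"] Cond.prems by auto
  next
    case 3
    then show ?thesis using Cond.IH(2)[of "n + 2 + code_len c"] Cond.prems by auto
  qed
next
  case (Loop r P c)
  consider "q = n \<or> q = n + 1 + code_len c" | "q \<noteq> n" "q < n + 1 + code_len c"
    using Loop.prems by force
  then show ?case
  proof cases
    case 1
    then show ?thesis using Loop.prems stay_symbols[of rs] by auto
  next
    case 2
    then show ?thesis using Loop.IH[of "n + 1"] Loop.prems by auto
  qed
qed

text \<open>The top of the stack is under the head and the rest lies to its right. What is left of the head
  is arbitrary, so that popping only has to move the head.\<close>

definition stack_on :: "tape \<Rightarrow> nat list \<Rightarrow> bool" where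
  "stack_on t xs \<longleftrightarrow> (\<forall>i::nat. fst t (snd t + int i) = (if i < length xs then xs ! i else 0))"

definition top_of :: "nat list \<Rightarrow> nat" where
  "top_of xs = (case xs of [] \<Rightarrow> 0 | x # _ \<Rightarrow> x)"

lemma top_of_simps [simp]: "top_of [] = 0" "top_of (x # xs) = x"
  by (simp_all add: top_of_def)

lemma tape_read_stack: "stack_on t xs \<Longrightarrow> tape_read t = top_of xs"
  unfolding stack_on_def tape_read_def by (drule spec[of _ 0]) (auto split: list.splits simp: top_of_def)

lemma tape_act_stay [simp]: "tape_act (tape_read t, Move_Stay) t = t"
  by (cases t) (simp add: tape_act_def tape_read_def)

lemma stack_on_push:
  assumes "stack_on t xs"
  shows "stack_on (tape_act (a, Move_Stay) (tape_act (tape_read t, Move_Left) t)) (a # xs)"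
  unfolding stack_on_def
proof
  fix i :: nat
  show "fst (tape_act (a, Move_Stay) (tape_act (tape_read t, Move_Left) t))
     (snd (tape_act (a, Move_Stay) (tape_act (tape_read t, Move_Left) t)) + int i) =
     (if i < length (a # xs) then (a # xs) ! i else 0)"
  proof (cases i)
    case (Suc j)
    have "fst t (snd t + int j) = (if j < length xs then xs ! j else 0)"
      using assms by (simp add: stack_on_def)
    then show ?thesis by (simp add: Suc tape_act_def tape_read_def)
  qed (simp add: tape_act_def)
qed

lemma stack_on_pop:
  assumes "stack_on t (x # xs)"
  shows "stack_on (tape_act (tape_read t, Move_Right) t) xs"
  unfolding stack_on_def
proof
  fix i :: nat
  have "fst t (snd t + int (Suc i)) = (if i < length xs then xs ! i else 0)"
    using assms unfolding stack_on_def by (metis length_Cons not_less_eq nth_Cons_Suc)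
  then show "fst (tape_act (tape_read t, Move_Right) t)
      (snd (tape_act (tape_read t, Move_Right) t) + int i) = (if i < length xs then xs ! i else 0)"
    by (simp add: tape_act_def tape_read_def algebra_simps)
qed

lemma map2_stay [simp]: "map2 tape_act (stay (map tape_read ts)) ts = ts"
  by (induction ts) (simp_all add: stay_def)

lemma map2_stay_upd:
  "map2 tape_act ((stay (map tape_read ts))[r := x]) ts = ts[r := tape_act x (ts ! r)]"
proof (cases "r < length ts")
  case True
  have "map2 tape_act ((stay (map tape_read ts))[r := x]) (ts[r := ts ! r]) =
      (map2 tape_act (stay (map tape_read ts)) ts)[r := tape_act x (ts ! r)]"
    by (simp only: zip_update map_update prod.case)
  then show ?thesis using True by simp
next
  case False
  then show ?thesis by (simp add: list_update_beyond)
qed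

text \<open>The states below \<open>3\<close> are the initial and the halting ones.\<close>

definition hosts :: "tm \<Rightarrow> nat \<Rightarrow> com \<Rightarrow> bool" where
  "hosts M n c \<longleftrightarrow> n > 2 \<and> (\<forall>q rs. n \<le> q \<and> q < n + code_len c \<longrightarrow> tm_delta M q rs = code c n q rs)"

text \<open>A Hoare triple with time bound \<open>b\<close>. It quantifies over every machine and
  address hosting the code, so it can be reused inside larger programs, and over all tapes that
  represent the stacks, since the cells left of a head hold garbage.\<close>

definition runs :: "com \<Rightarrow> nat list list \<Rightarrow> nat \<Rightarrow> nat list list \<Rightarrow> bool" where
  "runs c s b s' \<longleftrightarrow> (\<forall>M n ts. hosts M n c \<and> list_all2 stack_on ts s \<longrightarrow>
     (\<exists>t\<le>b. \<exists>ts'. (tm_step M ^^ t) (n, ts) = (n + code_len c, ts') \<and> list_all2 stack_on ts' s'))"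

lemma runsI:
  assumes "\<And>M n ts. hosts M n c \<Longrightarrow> list_all2 stack_on ts s \<Longrightarrow>
     \<exists>t\<le>b. \<exists>ts'. (tm_step M ^^ t) (n, ts) = (n + code_len c, ts') \<and> list_all2 stack_on ts' s'"
  shows "runs c s b s'"
  using assms by (simp add: runs_def)

lemma runsD:
  assumes "runs c s b s'" "hosts M n c" "list_all2 stack_on ts s"
  obtains t ts' where "t \<le> b" "(tm_step M ^^ t) (n, ts) = (n + code_len c, ts')"
    "list_all2 stack_on ts' s'"
  using assms unfolding runs_def by blast

lemma runs_mono: "runs c s b s' \<Longrightarrow> b \<le> b' \<Longrightarrow> runs c s b' s'"
  unfolding runs_def by (meson le_trans)

lemma tm_step_working: "q > 2 \<Longrightarrow> tm_step M (q, ts) =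
    (fst (tm_delta M q (map tape_read ts)), map2 tape_act (snd (tm_delta M q (map tape_read ts))) ts)"
  by (simp add: tm_step_def halting_def case_prod_unfold)

lemma hosts_step:
  assumes "hosts M n c" "n \<le> q" "q < n + code_len c"
  shows "tm_step M (q, ts) = (fst (code c n q (map tape_read ts)),
     map2 tape_act (snd (code c n q (map tape_read ts))) ts)"
  using assms by (simp add: hosts_def tm_step_working)

lemma reads_stacks: "list_all2 stack_on ts s \<Longrightarrow> map tape_read ts = map top_of s"
  by (induction rule: list_all2_induct) (auto simp: tape_read_stack)

lemma read_nth:
  "list_all2 stack_on ts s \<Longrightarrow> r < length s \<Longrightarrow> tape_read (ts ! r) = top_of (s ! r)"
  by (simp add: list_all2_conv_all_nth tape_read_stack)

lemma runs_Push:
  assumes "r < length s"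
  shows "runs (Push r a) s 2 (s[r := a # s ! r])"
proof (rule runsI)
  fix M n ts
  assume h: "hosts M n (Push r a)" and ts: "list_all2 stack_on ts s"
  have len: "length ts = length s" using ts by (rule list_all2_lengthD)
  let ?t1 = "tape_act (tape_read (ts ! r), Move_Left) (ts ! r)"
  let ?t2 = "tape_act (a, Move_Stay) ?t1"
  have "tm_step M (n, ts) = (n + 1, ts[r := ?t1])"
    using assms len by (simp add: hosts_step[OF h] map2_stay_upd)
  moreover have "tm_step M (n + 1, ts[r := ?t1]) = (n + 2, ts[r := ?t2])"
    using assms len by (simp add: hosts_step[OF h] map2_stay_upd del: map_update)
  ultimately have "(tm_step M ^^ 2) (n, ts) = (n + code_len (Push r a), ts[r := ?t2])"
    by (simp add: numeral_2_eq_2)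
  moreover have "list_all2 stack_on (ts[r := ?t2]) (s[r := a # s ! r])"
    using ts assms by (intro list_all2_update_cong) (auto intro!: stack_on_push simp: list_all2_conv_all_nth)
  ultimately show "\<exists>t\<le>2. \<exists>ts'. (tm_step M ^^ t) (n, ts) = (n + code_len (Push r a), ts') \<and>
      list_all2 stack_on ts' (s[r := a # s ! r])" by blast
qed

lemma runs_Copy:
  assumes "r < length s" "r' < length s" "r \<noteq> r'"
  shows "runs (Copy r r') s 2 (s[r' := top_of (s ! r) # s ! r'])"
proof (rule runsI)
  fix M n ts
  assume h: "hosts M n (Copy r r')" and ts: "list_all2 stack_on ts s"
  have len: "length ts = length s" using ts by (rule list_all2_lengthD)
  let ?t1 = "tape_act (tape_read (ts ! r'), Move_Left) (ts ! r')"
  let ?t2 = "tape_act (top_of (s ! r), Move_Stay) ?t1"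
  have "tm_step M (n, ts) = (n + 1, ts[r' := ?t1])"
    using assms len by (simp add: hosts_step[OF h] map2_stay_upd)
  moreover have "tm_step M (n + 1, ts[r' := ?t1]) = (n + 2, ts[r' := ?t2])"
    using assms len by (simp add: hosts_step[OF h] map2_stay_upd read_nth[OF ts] del: map_update)
  ultimately have "(tm_step M ^^ 2) (n, ts) = (n + code_len (Copy r r'), ts[r' := ?t2])"
    by (simp add: numeral_2_eq_2)
  moreover have "list_all2 stack_on (ts[r' := ?t2]) (s[r' := top_of (s ! r) # s ! r'])"
    using ts assms by (intro list_all2_update_cong) (auto intro!: stack_on_push simp: list_all2_conv_all_nth)
  ultimately show "\<exists>t\<le>2. \<exists>ts'. (tm_step M ^^ t) (n, ts) = (n + code_len (Copy r r'), ts') \<and>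
      list_all2 stack_on ts' (s[r' := top_of (s ! r) # s ! r'])" by blast
qed

lemma runs_Pop:
  assumes "r < length s" "s ! r = x # xs"
  shows "runs (Pop r) s 1 (s[r := xs])"
proof (rule runsI)
  fix M n ts
  assume h: "hosts M n (Pop r)" and ts: "list_all2 stack_on ts s"
  have len: "length ts = length s" using ts by (rule list_all2_lengthD)
  let ?t1 = "tape_act (tape_read (ts ! r), Move_Right) (ts ! r)"
  have "tm_step M (n, ts) = (n + 1, ts[r := ?t1])"
    using assms len by (simp add: hosts_step[OF h] map2_stay_upd)
  then have "(tm_step M ^^ 1) (n, ts) = (n + code_len (Pop r), ts[r := ?t1])"
    by simp
  moreover have "stack_on (ts ! r) (x # xs)"
    using assms ts by (metis list_all2_nthD2)
  then have "list_all2 stack_on (ts[r := ?t1]) (s[r := xs])"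
    using ts by (intro list_all2_update_cong stack_on_pop)
  ultimately show "\<exists>t\<le>1. \<exists>ts'. (tm_step M ^^ t) (n, ts) = (n + code_len (Pop r), ts') \<and>
      list_all2 stack_on ts' (s[r := xs])" by blast
qed

lemma funpow_trans: "(f ^^ t) x = y \<Longrightarrow> (f ^^ u) y = z \<Longrightarrow> (f ^^ (t + u)) x = z"
  by (metis add.commute comp_apply funpow_add)

lemma runs_Seq:
  assumes "runs c s b s'" "runs d s' b' s''"
  shows "runs (c ;; d) s (b + b') s''"
proof (rule runsI)
  fix M n ts
  assume h: "hosts M n (c ;; d)" and ts: "list_all2 stack_on ts s"
  have "hosts M n c" "hosts M (n + code_len c) d"
    using h by (auto simp: hosts_def)
  then obtain t ts' where 1: "t \<le> b" "(tm_step M ^^ t) (n, ts) = (n + code_len c, ts')"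
      and ts': "list_all2 stack_on ts' s'"
    using assms(1) ts by (blast elim: runsD)
  obtain t' ts'' where 2: "t' \<le> b'"
      "(tm_step M ^^ t') (n + code_len c, ts') = (n + code_len c + code_len d, ts'')"
      and ts'': "list_all2 stack_on ts'' s''"
    using \<open>hosts M (n + code_len c) d\<close> assms(2) ts' by (blast elim: runsD)
  have "(tm_step M ^^ (t + t')) (n, ts) = (n + code_len (c ;; d), ts'')"
    using funpow_trans[OF 1(2) 2(2)] by (simp add: add.assoc)
  then show "\<exists>t\<le>b + b'. \<exists>ts'. (tm_step M ^^ t) (n, ts) = (n + code_len (c ;; d), ts') \<and>
      list_all2 stack_on ts' s''"
    using 1(1) 2(1) ts'' by (meson add_mono)
qed

text \<open>The two extra steps are the test and the jump over \<open>d\<close>. The other branch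
  pays for the test only, since \<open>d\<close> already ends at the exit.\<close>

lemma runs_Cond_True:
  assumes "runs c s b s'" "r < length s" "P (top_of (s ! r))"
  shows "runs (Cond r P c d) s (b + 2) s'"
proof (rule runsI)
  fix M n ts
  assume h: "hosts M n (Cond r P c d)" and ts: "list_all2 stack_on ts s"
  have "hosts M (n + 1) c" using h by (auto simp: hosts_def)
  then obtain t ts' where 1: "t \<le> b" "(tm_step M ^^ t) (n + 1, ts) = (n + 1 + code_len c, ts')"
      and ts': "list_all2 stack_on ts' s'"
    using assms(1) ts by (blast elim: runsD)
  have "(tm_step M ^^ 1) (n, ts) = (n + 1, ts)"
    using assms(2,3) list_all2_lengthD[OF ts] by (simp add: hosts_step[OF h] read_nth[OF ts])
  moreover have "(tm_step M ^^ 1) (n + 1 + code_len c, ts') = (n + code_len (Cond r P c d), ts')"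
    by (simp add: hosts_step[OF h])
  ultimately have "(tm_step M ^^ (1 + (t + 1))) (n, ts) = (n + code_len (Cond r P c d), ts')"
    by (intro funpow_trans[OF _ funpow_trans[OF 1(2)]])
  then show "\<exists>t\<le>b + 2. \<exists>ts'. (tm_step M ^^ t) (n, ts) = (n + code_len (Cond r P c d), ts') \<and>
      list_all2 stack_on ts' s'"
    using 1(1) ts' by (intro exI[of _ "1 + (t + 1)"]) auto
qed

lemma runs_Cond_False:
  assumes "runs d s b s'" "r < length s" "\<not> P (top_of (s ! r))"
  shows "runs (Cond r P c d) s (b + 1) s'"
proof (rule runsI)
  fix M n ts
  assume h: "hosts M n (Cond r P c d)" and ts: "list_all2 stack_on ts s"
  have "hosts M (n + 2 + code_len c) d" using h by (auto simp: hosts_def)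
  then obtain t ts' where 1: "t \<le> b"
      "(tm_step M ^^ t) (n + 2 + code_len c, ts) = (n + 2 + code_len c + code_len d, ts')"
      and ts': "list_all2 stack_on ts' s'"
    using assms(1) ts by (blast elim: runsD)
  have "(tm_step M ^^ 1) (n, ts) = (n + 2 + code_len c, ts)"
    using assms(2,3) list_all2_lengthD[OF ts] by (simp add: hosts_step[OF h] read_nth[OF ts])
  from funpow_trans[OF this 1(2)]
  have "(tm_step M ^^ (1 + t)) (n, ts) = (n + code_len (Cond r P c d), ts')"
    by (simp add: ac_simps)
  then show "\<exists>t\<le>b + 1. \<exists>ts'. (tm_step M ^^ t) (n, ts) = (n + code_len (Cond r P c d), ts') \<and>
      list_all2 stack_on ts' s'"
    using 1(1) ts' by (intro exI[of _ "1 + t"]) auto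
qed

lemma runs_Loop_False:
  assumes "r < length s" "\<not> P (top_of (s ! r))"
  shows "runs (Loop r P c) s 1 s"
proof (rule runsI)
  fix M n ts
  assume h: "hosts M n (Loop r P c)" and ts: "list_all2 stack_on ts s"
  have "(tm_step M ^^ 1) (n, ts) = (n + code_len (Loop r P c), ts)"
    using assms list_all2_lengthD[OF ts] by (simp add: hosts_step[OF h] read_nth[OF ts])
  then show "\<exists>t\<le>1. \<exists>ts'. (tm_step M ^^ t) (n, ts) = (n + code_len (Loop r P c), ts') \<and>
      list_all2 stack_on ts' s"
    using ts by blast
qed

text \<open>Unfolds one round. The remaining run is again one of the same loop, so loops are
  analysed by induction on the data rather than by an invariant.\<close>

lemma runs_Loop_True:
  assumes "r < length s" "P (top_of (s ! r))" "runs c s b s'" "runs (Loop r P c) s' b' s''"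
  shows "runs (Loop r P c) s (b + b' + 2) s''"
proof (rule runsI)
  fix M n ts
  assume h: "hosts M n (Loop r P c)" and ts: "list_all2 stack_on ts s"
  have "hosts M (n + 1) c" using h by (auto simp: hosts_def)
  then obtain t ts' where 1: "t \<le> b" "(tm_step M ^^ t) (n + 1, ts) = (n + 1 + code_len c, ts')"
      and ts': "list_all2 stack_on ts' s'"
    using assms(3) ts by (blast elim: runsD)
  obtain t' ts'' where 2: "t' \<le> b'" "(tm_step M ^^ t') (n, ts') = (n + code_len (Loop r P c), ts'')"
      and ts'': "list_all2 stack_on ts'' s''"
    using h assms(4) ts' by (blast elim: runsD)
  have "(tm_step M ^^ 1) (n, ts) = (n + 1, ts)"
    using assms(1,2) list_all2_lengthD[OF ts] by (simp add: hosts_step[OF h] read_nth[OF ts])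
  moreover have "(tm_step M ^^ 1) (n + 1 + code_len c, ts') = (n, ts')"
    by (simp add: hosts_step[OF h])
  ultimately have "(tm_step M ^^ (1 + (t + (1 + t')))) (n, ts) = (n + code_len (Loop r P c), ts'')"
    by (intro funpow_trans[OF _ funpow_trans[OF 1(2) funpow_trans[OF _ 2(2)]]])
  then show "\<exists>t\<le>b + b' + 2. \<exists>ts'. (tm_step M ^^ t) (n, ts) = (n + code_len (Loop r P c), ts') \<and>
      list_all2 stack_on ts' s''"
    using 1(1) 2(1) ts'' by (intro exI[of _ "1 + (t + (1 + t'))"]) auto
qed

section \<open>Trees in prefix notation on a stack\<close>

datatype tree = Leaf | Node tree tree

text \<open>A 2 raises the number of subtrees still to come by one, a 1 lowers it by one, and the
  code ends where this number, started at 1, reaches 0. The symbol 0 is avoided because it is the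
  blank.\<close>

primrec enc_tree :: "tree \<Rightarrow> nat list" where
  "enc_tree Leaf = [1]"
| "enc_tree (Node s t) = 2 # enc_tree s @ enc_tree t"

lemma enc_tree_not_marker [simp]: "3 \<notin> set (enc_tree t)"
  by (induction t) auto

lemma runs_Push3:
  "runs (Push 0 a) [A, B, C] 2 [a # A, B, C]"
  "runs (Push 1 a) [A, B, C] 2 [A, a # B, C]"
  "runs (Push 2 a) [A, B, C] 2 [A, B, a # C]"
  using runs_Push[of 0 "[A, B, C]" a] runs_Push[of 1 "[A, B, C]" a] runs_Push[of 2 "[A, B, C]" a]
  by (simp_all add: numeral_2_eq_2)

lemma runs_Pop3:
  "runs (Pop 0) [a # A, B, C] 1 [A, B, C]"
  "runs (Pop 1) [A, a # B, C] 1 [A, B, C]"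
  "runs (Pop 2) [A, B, a # C] 1 [A, B, C]"
  using runs_Pop[of 0 "[a # A, B, C]"] runs_Pop[of 1 "[A, a # B, C]"] runs_Pop[of 2 "[A, B, a # C]"]
  by (simp_all add: numeral_2_eq_2)

lemma runs_Copy3:
  "runs (Copy 0 1) [a # A, B, C] 2 [a # A, a # B, C]"
  "runs (Copy 1 0) [A, a # B, C] 2 [a # A, a # B, C]"
  "runs (Copy 1 2) [A, a # B, C] 2 [A, a # B, a # C]"
  using runs_Copy[of 0 "[a # A, B, C]" 1] runs_Copy[of 1 "[A, a # B, C]" 0]
    runs_Copy[of 1 "[A, a # B, C]" 2]
  by (simp_all add: numeral_2_eq_2)

text \<open>Besides the symbols \<open>1\<close> and \<open>2\<close> of trees, the symbol \<open>3\<close> is used to mark on an auxiliary stack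
  where temporary data ends.\<close>

definition move_until_marker :: "nat \<Rightarrow> nat \<Rightarrow> com" where
  "move_until_marker r r' = Loop r (\<lambda>a. a \<noteq> 3) (Copy r r' ;; Pop r) ;; Pop r"

text \<open>Each symbol costs 2 for \<open>Copy\<close>, 1 for \<open>Pop\<close> and 2 for the test
  and the jump back; the final 2 are the failing test and the removal of the marker.\<close>

lemma runs_move:
  assumes "3 \<notin> set xs" "r < length s" "r' < length s" "r \<noteq> r'" "s ! r = xs @ 3 # ys"
  shows "runs (move_until_marker r r') s (5 * length xs + 2) (s[r := ys, r' := rev xs @ s ! r'])"
proof -
  have "runs (Loop r (\<lambda>a. a \<noteq> 3) (Copy r r' ;; Pop r)) s (5 * length xs + 1)
      (s[r := 3 # ys, r' := rev xs @ s ! r'])"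
    using assms
  proof (induction xs arbitrary: s)
    case Nil
    then have "s[r := 3 # ys, r' := s ! r'] = s"
      by (metis append_Nil list_update_id)
    with Nil runs_Loop_False[of r s "\<lambda>a. a \<noteq> 3"] show ?case by simp
  next
    case (Cons x xs)
    let ?s' = "s[r' := x # s ! r']" and ?s'' = "s[r' := x # s ! r', r := xs @ 3 # ys]"
    have 1: "runs (Copy r r') s 2 ?s'"
      using runs_Copy[of r s r'] Cons.prems by simp
    have 2: "runs (Pop r) ?s' 1 ?s''"
      using runs_Pop[of r ?s' x "xs @ 3 # ys"] Cons.prems by simp
    have 3: "runs (Loop r (\<lambda>a. a \<noteq> 3) (Copy r r' ;; Pop r)) ?s'' (5 * length xs + 1)
        (?s''[r := 3 # ys, r' := rev xs @ ?s'' ! r'])"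
      by (rule Cons.IH) (use Cons.prems in simp_all)
    have 4: "?s''[r := 3 # ys, r' := rev xs @ ?s'' ! r'] = s[r := 3 # ys, r' := rev (x # xs) @ s ! r']"
      using Cons.prems(2-4)
      by (simp add: list_update_swap[of r' r])
    show ?case
      by (rule runs_mono[OF runs_Loop_True[OF _ _ runs_Seq[OF 1 2] 3[unfolded 4]]])
        (use Cons.prems in simp_all)
  qed
  from runs_Seq[OF this, of "Pop r" 1 "s[r := ys, r' := rev xs @ s ! r']"]
  show ?thesis
    using runs_Pop[of r "s[r := 3 # ys, r' := rev xs @ s ! r']" 3 ys] assms(2-4)
    by (simp add: move_until_marker_def list_update_swap[of r' r])
qed

lemma runs_move3:
  assumes "3 \<notin> set xs"
  shows "runs (move_until_marker 1 0) [A, xs @ 3 # B, C] (5 * length xs + 2) [rev xs @ A, B, C]"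
    "runs (move_until_marker 1 2) [A, xs @ 3 # B, C] (5 * length xs + 2) [A, B, rev xs @ C]"
    "runs (move_until_marker 2 1) [A, B, xs @ 3 # C] (5 * length xs + 2) [A, rev xs @ B, C]"
  using runs_move[OF assms, of 1 "[A, xs @ 3 # B, C]" 0 B] runs_move[OF assms, of 1 "[A, xs @ 3 # B, C]" 2 B]
    runs_move[OF assms, of 2 "[A, B, xs @ 3 # C]" 1 C]
  by (simp_all add: numeral_2_eq_2)

definition move2_until_marker :: com where
  "move2_until_marker = Loop 1 (\<lambda>a. a \<noteq> 3) (Copy 1 0 ;; Copy 1 2 ;; Pop 1) ;; Pop 1"

lemma runs_move2:
  assumes "3 \<notin> set xs"
  shows "runs move2_until_marker [A, xs @ 3 # B, C] (7 * length xs + 2) [rev xs @ A, B, rev xs @ C]"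
proof -
  have "runs (Loop 1 (\<lambda>a. a \<noteq> 3) (Copy 1 0 ;; Copy 1 2 ;; Pop 1)) [A, xs @ 3 # B, C]
      (7 * length xs + 1) [rev xs @ A, 3 # B, rev xs @ C]"
    using assms
  proof (induction xs arbitrary: A C)
    case Nil
    show ?case
      using runs_Loop_False[of 1 "[A, 3 # B, C]" "\<lambda>a. a \<noteq> 3"] by simp
  next
    case (Cons x xs)
    have 1: "runs (Copy 1 0 ;; Copy 1 2 ;; Pop 1) [A, (x # xs) @ 3 # B, C] (2 + (2 + 1))
        [x # A, xs @ 3 # B, x # C]"
      unfolding append_Cons by (rule runs_Seq runs_Copy3 runs_Pop3)+
    have "x \<noteq> 3" "3 \<notin> set xs" using Cons.prems by auto
    from runs_Loop_True[OF _ _ 1 Cons.IH[OF this(2)]] this(1) show ?case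
      by (auto intro: runs_mono)
  qed
  from runs_Seq[OF this runs_Pop3(2)] show ?thesis
    by (simp add: move2_until_marker_def)
qed

lemma two_neq_one: "(2::nat) \<noteq> 1"
  by simp

text \<open>Stack \<open>2\<close> counts, in unary, the subtrees that are still to be read.\<close>

definition shift_tree :: com where
  "shift_tree = Push 1 3 ;; Push 2 3 ;; Push 2 1 ;;
     Loop 2 (\<lambda>a. a = 1) (Copy 0 1 ;; Cond 0 (\<lambda>a. a = 1) (Pop 2) (Push 2 1) ;; Pop 0) ;; Pop 2"

lemma runs_Cond3_True:
  "runs c [a # A, B, C] b s' \<Longrightarrow> P a \<Longrightarrow> runs (Cond 0 P c d) [a # A, B, C] (b + 2) s'"
  using runs_Cond_True[of c "[a # A, B, C]" b s' 0 P d] by simp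

lemma runs_Cond3_False:
  "runs d [a # A, B, C] b s' \<Longrightarrow> \<not> P a \<Longrightarrow> runs (Cond 0 P c d) [a # A, B, C] (b + 1) s'"
  using runs_Cond_False[of d "[a # A, B, C]" b s' 0 P c] by simp

lemma runs_Loop_2:
  assumes "P x" "runs c [A, B, x # C] b s'" "runs (Loop 2 P c) s' b' s''"
  shows "runs (Loop 2 P c) [A, B, x # C] (b + b' + 2) s''"
  by (rule runs_Loop_True[OF _ _ assms(2,3)]) (simp_all add: assms)

lemma runs_Loop_2_end:
  "\<not> P x \<Longrightarrow> runs (Loop 2 P c) [A, B, x # C] 1 [A, B, x # C]"
  using runs_Loop_False[of 2 "[A, B, x # C]" P c] by simp

text \<open>The tree arrives reversed above a marker, the form from which
  \<open>move_until_marker\<close> restores it. Raising and lowering the counter take equally long,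
  so every symbol costs 8.\<close>

lemma runs_shift_tree:
  "runs shift_tree [enc_tree t @ A, B, C] (8 * length (enc_tree t) + 8)
     [A, rev (enc_tree t) @ 3 # B, C]"
proof -
  let ?l = "Loop 2 (\<lambda>a. a = 1) (Copy 0 1 ;; Cond 0 (\<lambda>a. a = 1) (Pop 2) (Push 2 1) ;; Pop 0)"
  \<comment> \<open>Continuation form: after reading \<open>t\<close> the loop goes on if more
    subtrees are due, so the claim prefixes the reading of \<open>t\<close> to an arbitrary further
    run. At a node it is applied to both subtrees in turn.\<close>
  have loop: "runs ?l [A, rev (enc_tree t) @ B, C] b s' \<Longrightarrow>
      runs ?l [enc_tree t @ A, B, 1 # C] (8 * length (enc_tree t) + b) s'" for A B C b s'
  proof (induction t arbitrary: A B C b s')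
    case Leaf
    have "runs (Copy 0 1 ;; Cond 0 (\<lambda>a. a = 1) (Pop 2) (Push 2 1) ;; Pop 0) [1 # A, B, 1 # C]
        (2 + ((1 + 2) + 1)) [A, 1 # B, C]"
      by (rule runs_Seq runs_Copy3(1) runs_Cond3_True runs_Pop3 refl)+
    then show ?case using Leaf by (auto intro: runs_mono[OF runs_Loop_2])
  next
    case (Node t u)
    have 1: "runs (Copy 0 1 ;; Cond 0 (\<lambda>a. a = 1) (Pop 2) (Push 2 1) ;; Pop 0)
        [2 # enc_tree t @ enc_tree u @ A, B, 1 # C]
        (2 + ((2 + 1) + 1)) [enc_tree t @ enc_tree u @ A, 2 # B, 1 # 1 # C]"
      by (rule runs_Seq runs_Copy3(1) runs_Cond3_False runs_Push3(3) runs_Pop3 two_neq_one)+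
    have 2: "runs ?l [enc_tree u @ A, rev (enc_tree t) @ 2 # B, 1 # C] (8 * length (enc_tree u) + b) s'"
      using Node.IH(2)[of A "rev (enc_tree t) @ 2 # B" C b s'] Node.prems by simp
    show ?case
      using runs_mono[OF runs_Loop_2[OF _ 1 Node.IH(1)[OF 2]]] by simp
  qed
  \<comment> \<open>The 3 below the counter makes the loop test fail once the tree is read; without
    it, a 1 on top of the caller's \<open>C\<close> would count as a pending subtree.\<close>
  have "runs ?l [enc_tree t @ A, 3 # B, 1 # 3 # C] (8 * length (enc_tree t) + 1)
      [A, rev (enc_tree t) @ 3 # B, 3 # C]"
    by (rule loop) (rule runs_Loop_2_end, simp)
  then have "runs shift_tree [enc_tree t @ A, B, C] (2 + (2 + (2 + ((8 * length (enc_tree t) + 1) + 1))))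
      [A, rev (enc_tree t) @ 3 # B, C]"
    unfolding shift_tree_def by - (rule runs_Seq runs_Push3 runs_Pop3 | assumption)+
  then show ?thesis by (rule runs_mono) simp
qed

definition drop_tree :: com where
  "drop_tree = Push 2 3 ;; Push 2 1 ;;
     Loop 2 (\<lambda>a. a = 1) (Cond 0 (\<lambda>a. a = 1) (Pop 2) (Push 2 1) ;; Pop 0) ;; Pop 2"

lemma runs_drop_tree:
  "runs drop_tree [enc_tree t @ A, B, C] (6 * length (enc_tree t) + 6) [A, B, C]"
proof -
  let ?l = "Loop 2 (\<lambda>a. a = 1) (Cond 0 (\<lambda>a. a = 1) (Pop 2) (Push 2 1) ;; Pop 0)"
  have loop: "runs ?l [A, B, C] b s' \<Longrightarrow>
      runs ?l [enc_tree t @ A, B, 1 # C] (6 * length (enc_tree t) + b) s'" for A C b s'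
  proof (induction t arbitrary: A C b s')
    case Leaf
    have "runs (Cond 0 (\<lambda>a. a = 1) (Pop 2) (Push 2 1) ;; Pop 0) [1 # A, B, 1 # C]
        ((1 + 2) + 1) [A, B, C]"
      by (rule runs_Seq runs_Cond3_True runs_Pop3 refl)+
    then show ?case using Leaf by (auto intro: runs_mono[OF runs_Loop_2])
  next
    case (Node t u)
    have 1: "runs (Cond 0 (\<lambda>a. a = 1) (Pop 2) (Push 2 1) ;; Pop 0)
        [2 # enc_tree t @ enc_tree u @ A, B, 1 # C]
        ((2 + 1) + 1) [enc_tree t @ enc_tree u @ A, B, 1 # 1 # C]"
      by (rule runs_Seq runs_Cond3_False runs_Push3(3) runs_Pop3 two_neq_one)+
    show ?case
      using runs_mono[OF runs_Loop_2[OF _ 1 Node.IH(1)[OF Node.IH(2)[OF Node.prems]]]] by simp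
  qed
  have "runs ?l [enc_tree t @ A, B, 1 # 3 # C] (6 * length (enc_tree t) + 1) [A, B, 3 # C]"
    by (rule loop) (rule runs_Loop_2_end, simp)
  then have "runs drop_tree [enc_tree t @ A, B, C] (2 + (2 + ((6 * length (enc_tree t) + 1) + 1))) [A, B, C]"
    unfolding drop_tree_def by - (rule runs_Seq runs_Push3 runs_Pop3 | assumption)+
  then show ?thesis by (rule runs_mono) simp
qed

lemma runs_move_tree:
  "runs (move_until_marker 1 0) [A, rev (enc_tree t) @ 3 # B, C] (5 * length (enc_tree t) + 2)
     [enc_tree t @ A, B, C]"
  "runs (move_until_marker 1 2) [A, rev (enc_tree t) @ 3 # B, C] (5 * length (enc_tree t) + 2)
     [A, B, enc_tree t @ C]"
  "runs (move_until_marker 2 1) [A, B, enc_tree t @ 3 # C] (5 * length (enc_tree t) + 2)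
     [A, rev (enc_tree t) @ B, C]"
  "runs move2_until_marker [A, rev (enc_tree t) @ 3 # B, C] (7 * length (enc_tree t) + 2)
     [enc_tree t @ A, B, enc_tree t @ C]"
  using runs_move3(1,2)[of "rev (enc_tree t)"] runs_move3(3)[of "enc_tree t"]
    runs_move2[of "rev (enc_tree t)"] by simp_all

text \<open>Every transfer reverses the order, so a copy must make an even number of them: one goes
  back directly from stack 1, the other via stacks 1, 2 and 1.\<close>

definition dup_tree :: com where
  "dup_tree = shift_tree ;; Push 2 3 ;; move2_until_marker ;; Push 1 3 ;; move_until_marker 2 1 ;;
     move_until_marker 1 0"

lemma runs_dup_tree:
  "runs dup_tree [enc_tree t @ A, B, C] (25 * length (enc_tree t) + 18) [enc_tree t @ enc_tree t @ A, B, C]"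
  unfolding dup_tree_def
  by (rule runs_mono, (rule runs_Seq runs_shift_tree runs_Push3 runs_move_tree)+, simp)

text \<open>The upper tree is shifted first and ends up lower on stack 1. The other one is parked on
  stack 2 until the first is back on stack 0.\<close>

definition swap_tree :: com where
  "swap_tree = shift_tree ;; shift_tree ;; Push 2 3 ;; move_until_marker 1 2 ;;
     move_until_marker 1 0 ;; Push 1 3 ;; move_until_marker 2 1 ;; move_until_marker 1 0"

lemma runs_swap_tree:
  "runs swap_tree [enc_tree t @ enc_tree u @ A, B, C]
     (23 * (length (enc_tree t) + length (enc_tree u)) + 28) [enc_tree u @ enc_tree t @ A, B, C]"
  unfolding swap_tree_def
  by (rule runs_mono, (rule runs_Seq runs_shift_tree runs_Push3 runs_move_tree)+, simp)

section \<open>Functions computable in polynomial time\<close>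

text \<open>The coefficients are natural numbers, so no term decreases. This lets a size bound be
  substituted into the time bound of the next program.\<close>

lemma poly_nat_mono: "m \<le> n \<Longrightarrow> poly p m \<le> poly p (n::nat)"
  by (induction p) (auto intro: add_mono mult_mono)

class encodable =
  fixes to_tree :: "'a \<Rightarrow> tree"

abbreviation code_of :: "'a::encodable \<Rightarrow> nat list" where
  "code_of x \<equiv> enc_tree (to_tree x)"

abbreviation tsize :: "'a::encodable \<Rightarrow> nat" where
  "tsize x \<equiv> length (enc_tree (to_tree x))"

instantiation bool :: encodable
begin
definition to_tree_bool :: "bool \<Rightarrow> tree" where
  "to_tree_bool b = (if b then Node Leaf Leaf else Leaf)"
instance ..
end

instantiation prod :: (encodable, encodable) encodable
begin
definition to_tree_prod :: "'a \<times> 'b \<Rightarrow> tree" where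
  "to_tree_prod p = Node (to_tree (fst p)) (to_tree (snd p))"
instance ..
end

instantiation list :: (encodable) encodable
begin
text \<open>A nonempty list has the tree of the pair of its head and tail, so \<open>Cons\<close> is
  just pairing, and the top symbol tells whether a list is empty.\<close>

primrec to_tree_list :: "'a list \<Rightarrow> tree" where
  "to_tree_list [] = Leaf"
| "to_tree_list (x # xs) = Node (to_tree x) (to_tree_list xs)"
instance ..
end

text \<open>The program must leave alone whatever lies on the stacks below its argument; this is what makes
  programs composable without allocating registers.\<close>

definition polytime :: "('a::encodable \<Rightarrow> 'b::encodable) \<Rightarrow> bool" where
  "polytime f \<longleftrightarrow> (\<exists>c (p :: nat poly). wf_com c \<and> (\<forall>x. tsize (f x) \<le> poly p (tsize x)) \<and>
     (\<forall>x A B C. runs c [code_of x @ A, B, C] (poly p (tsize x)) [code_of (f x) @ A, B, C]))"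

lemma polytimeI:
  fixes p q :: "nat poly"
  assumes "wf_com c" "\<And>x. tsize (f x) \<le> poly p (tsize x)"
    "\<And>x A B C. runs c [code_of x @ A, B, C] (poly q (tsize x)) [code_of (f x) @ A, B, C]"
  shows "polytime f"
  unfolding polytime_def
proof (intro exI[of _ c] exI[of _ "p + q"] conjI allI)
  show "tsize (f x) \<le> poly (p + q) (tsize x)" for x
    using assms(2)[of x] by simp
  show "runs c [code_of x @ A, B, C] (poly (p + q) (tsize x)) [code_of (f x) @ A, B, C]" for x A B C
    using runs_mono[OF assms(3)] by simp
qed (fact assms(1))

lemma polytimeE:
  assumes "polytime f"
  obtains c p where "wf_com c" "\<And>x. tsize (f x) \<le> poly p (tsize x)"
    "\<And>x A B C. runs c [code_of x @ A, B, C] (poly p (tsize x)) [code_of (f x) @ A, B, C]"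
  using assms unfolding polytime_def by blast

text \<open>Programs see only trees, so changing the type while keeping the tree is free. The same
  rule replaces a function by an equal one.\<close>

lemma polytime_retype:
  assumes "polytime f" "\<And>x. to_tree (g x) = to_tree (f x)"
  shows "polytime g"
  using assms unfolding polytime_def by simp

lemma wf_tree_coms [simp]:
  "wf_com shift_tree" "wf_com drop_tree" "wf_com dup_tree" "wf_com swap_tree"
  "wf_com (move_until_marker 1 0)" "wf_com (move_until_marker (Suc 0) 0)"
  by (simp_all add: shift_tree_def drop_tree_def dup_tree_def swap_tree_def move_until_marker_def
      move2_until_marker_def)

lemma polytime_id: "polytime (\<lambda>x. x)"
  \<comment> \<open>There is no empty program; a push undone by a pop stands in for it.\<close>
  by (rule polytimeI[of "Push 0 1 ;; Pop 0" _ "[:0, 1:]" "[:3:]"])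
    (auto intro: runs_mono[OF runs_Seq[OF runs_Push3(1) runs_Pop3(1)]])

text \<open>The second program runs on an intermediate value. Its time is bounded in terms of
  \<open>x\<close> by means of the size bound contained in \<open>polytime\<close>.\<close>

lemma polytime_comp:
  assumes "polytime f" "polytime g"
  shows "polytime (\<lambda>x. g (f x))"
proof -
  obtain c p where c: "wf_com c" "\<And>x. tsize (f x) \<le> poly p (tsize x)"
    "\<And>x A B C. runs c [code_of x @ A, B, C] (poly p (tsize x)) [code_of (f x) @ A, B, C]"
    using polytimeE[OF assms(1)] by blast
  obtain d q where d: "wf_com d" "\<And>x. tsize (g x) \<le> poly q (tsize x)"
    "\<And>x A B C. runs d [code_of x @ A, B, C] (poly q (tsize x)) [code_of (g x) @ A, B, C]"
    using polytimeE[OF assms(2)] by blast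
  have q: "poly q (tsize (f x)) \<le> poly q (poly p (tsize x))" for x
    by (rule poly_nat_mono[OF c(2)])
  show ?thesis
  proof (rule polytimeI[of "c ;; d" _ "pcompose q p" "p + pcompose q p"])
    show "tsize (g (f x)) \<le> poly (pcompose q p) (tsize x)" for x
      using d(2)[of "f x"] q[of x] by (simp add: poly_pcompose)
    show "runs (c ;; d) [code_of x @ A, B, C] (poly (p + pcompose q p) (tsize x))
        [code_of (g (f x)) @ A, B, C]" for x A B C
      by (rule runs_mono[OF runs_Seq[OF c(3) d(3)]]) (use q[of x] in \<open>simp add: poly_pcompose\<close>)
  qed (use c d in simp)
qed

primrec push_all :: "nat list \<Rightarrow> com" where
  "push_all [] = Push 0 1 ;; Pop 0"
| "push_all (a # as) = push_all as ;; Push 0 a"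

lemma runs_push_all: "runs (push_all as) [A, B, C] (2 * length as + 3) [as @ A, B, C]"
proof (induction as)
  case Nil
  show ?case by (auto intro: runs_mono[OF runs_Seq[OF runs_Push3(1) runs_Pop3(1)]])
next
  case (Cons a as)
  show ?case using runs_mono[OF runs_Seq[OF Cons runs_Push3(1)]] by simp
qed

lemma wf_push_all: "wf_com (push_all (enc_tree t))"
proof -
  have "set as \<subseteq> {..<4} \<Longrightarrow> wf_com (push_all as)" for as
    by (induction as) auto
  moreover have "set (enc_tree t) \<subseteq> {..<4}"
    by (induction t) auto
  ultimately show ?thesis by blast
qed

lemma polytime_const: "polytime (\<lambda>_. a)"
proof (rule polytimeI[of "drop_tree ;; push_all (code_of a)" _ "[:tsize a:]" "[:2 * tsize a + 9, 6:]"])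
  show "runs (drop_tree ;; push_all (code_of a)) [code_of x @ A, B, C]
     (poly [:2 * tsize a + 9, 6:] (tsize x)) [code_of a @ A, B, C]" for x A B C
    by (rule runs_mono[OF runs_Seq[OF runs_drop_tree runs_push_all]]) simp
qed (use wf_push_all in simp_all)

lemma polytime_fst: "polytime (fst :: 'a::encodable \<times> 'b::encodable \<Rightarrow> 'a)"
proof (rule polytimeI[of "Pop 0 ;; shift_tree ;; drop_tree ;; move_until_marker 1 0" _ "[:0, 1:]" "[:17, 19:]"])
  fix x :: "'a \<times> 'b" and A B C
  show "runs (Pop 0 ;; shift_tree ;; drop_tree ;; move_until_marker 1 0) [code_of x @ A, B, C]
     (poly [:17, 19:] (tsize x)) [code_of (fst x) @ A, B, C]"
    unfolding to_tree_prod_def enc_tree.simps append_Cons append_assoc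
    by (rule runs_mono, (rule runs_Seq runs_Pop3(1) runs_shift_tree runs_drop_tree runs_move_tree)+, simp)
qed (simp_all add: to_tree_prod_def)

lemma polytime_snd: "polytime (snd :: 'a::encodable \<times> 'b::encodable \<Rightarrow> 'b)"
proof (rule polytimeI[of "Pop 0 ;; drop_tree" _ "[:0, 1:]" "[:7, 6:]"])
  fix x :: "'a \<times> 'b" and A B C
  show "runs (Pop 0 ;; drop_tree) [code_of x @ A, B, C]
     (poly [:7, 6:] (tsize x)) [code_of (snd x) @ A, B, C]"
    unfolding to_tree_prod_def enc_tree.simps append_Cons append_assoc
    by (rule runs_mono, (rule runs_Seq runs_Pop3(1) runs_drop_tree)+, simp)
qed (simp_all add: to_tree_prod_def)

text \<open>The second component is computed first, because the first one has to end up on top,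
  right below the 2 of the node.\<close>

lemma polytime_Pair:
  assumes "polytime f" "polytime g"
  shows "polytime (\<lambda>x. (f x, g x))"
proof -
  obtain c p where c: "wf_com c" "\<And>x. tsize (f x) \<le> poly p (tsize x)"
    "\<And>x A B C. runs c [code_of x @ A, B, C] (poly p (tsize x)) [code_of (f x) @ A, B, C]"
    using polytimeE[OF assms(1)] by blast
  obtain d q where d: "wf_com d" "\<And>x. tsize (g x) \<le> poly q (tsize x)"
    "\<And>x A B C. runs d [code_of x @ A, B, C] (poly q (tsize x)) [code_of (g x) @ A, B, C]"
    using polytimeE[OF assms(2)] by blast
  show ?thesis
  proof (rule polytimeI[of "dup_tree ;; d ;; swap_tree ;; c ;; Push 0 2" _ "[:1:] + p + q"
        "[:48, 48:] + [:24:] * q + p"])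
    fix x A B C
    show "tsize (f x, g x) \<le> poly ([:1:] + p + q) (tsize x)"
      using c(2)[of x] d(2)[of x] by (simp add: to_tree_prod_def)
    show "runs (dup_tree ;; d ;; swap_tree ;; c ;; Push 0 2) [code_of x @ A, B, C]
        (poly ([:48, 48:] + [:24:] * q + p) (tsize x)) [code_of (f x, g x) @ A, B, C]"
      unfolding to_tree_prod_def enc_tree.simps append_Cons append_assoc fst_conv snd_conv
      by (rule runs_mono, (rule runs_Seq runs_dup_tree d(3) runs_swap_tree c(3) runs_Push3(1))+)
        (use d(2)[of x] in simp)
  qed (use c d in simp)
qed

lemma polytime_If:
  assumes "polytime b" "polytime f" "polytime g"
  shows "polytime (\<lambda>x. if b x then f x else g x)"
proof -
  obtain c p where c: "wf_com c" "\<And>x. tsize (b x) \<le> poly p (tsize x)"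
    "\<And>x A B C. runs c [code_of x @ A, B, C] (poly p (tsize x)) [code_of (b x) @ A, B, C]"
    using polytimeE[OF assms(1)] by blast
  obtain d q where d: "wf_com d" "\<And>x. tsize (f x) \<le> poly q (tsize x)"
    "\<And>x A B C. runs d [code_of x @ A, B, C] (poly q (tsize x)) [code_of (f x) @ A, B, C]"
    using polytimeE[OF assms(2)] by blast
  obtain e r where e: "wf_com e" "\<And>x. tsize (g x) \<le> poly r (tsize x)"
    "\<And>x A B C. runs e [code_of x @ A, B, C] (poly r (tsize x)) [code_of (g x) @ A, B, C]"
    using polytimeE[OF assms(3)] by blast
  \<comment> \<open>\<open>False\<close> is coded by 1 and \<open>True\<close> by 2, 1, 1: one pop
    or three remove the condition.\<close>
  let ?c = "dup_tree ;; c ;; Cond 0 (\<lambda>a. a = 1) (Pop 0 ;; e) (Pop 0 ;; Pop 0 ;; Pop 0 ;; d)"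
  show ?thesis
  proof (rule polytimeI[of ?c _ "q + r" "[:22, 25:] + p + q + r"])
    fix x A B C
    show "tsize (if b x then f x else g x) \<le> poly (q + r) (tsize x)"
      using d(2)[of x] e(2)[of x] by simp
    have 1: "runs (Cond 0 (\<lambda>a. a = 1) (Pop 0 ;; e) (Pop 0 ;; Pop 0 ;; Pop 0 ;; d))
        [code_of (b x) @ code_of x @ A, B, C] (4 + poly q (tsize x) + poly r (tsize x))
        [code_of (if b x then f x else g x) @ A, B, C]"
    proof (cases "b x")
      case True
      have "runs (Pop 0 ;; Pop 0 ;; Pop 0 ;; d) [2 # 1 # 1 # code_of x @ A, B, C]
         (1 + (1 + (1 + poly q (tsize x)))) [code_of (f x) @ A, B, C]"
        by (rule runs_Seq runs_Pop3 d(3))+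
      from runs_mono[OF runs_Cond3_False[OF this, of "\<lambda>a. a = 1" "Pop 0 ;; e"],
          of "4 + poly q (tsize x) + poly r (tsize x)"] True
      show ?thesis by (simp add: to_tree_bool_def)
    next
      case False
      have "runs (Pop 0 ;; e) [1 # code_of x @ A, B, C]
         (1 + poly r (tsize x)) [code_of (g x) @ A, B, C]"
        by (rule runs_Seq runs_Pop3 e(3))+
      from runs_mono[OF runs_Cond3_True[OF this, of "\<lambda>a. a = 1" "Pop 0 ;; Pop 0 ;; Pop 0 ;; d"],
          of "4 + poly q (tsize x) + poly r (tsize x)"] False
      show ?thesis by (simp add: to_tree_bool_def)
    qed
    show "runs ?c [code_of x @ A, B, C] (poly ([:22, 25:] + p + q + r) (tsize x))
        [code_of (if b x then f x else g x) @ A, B, C]"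
      by (rule runs_mono, (rule runs_Seq runs_dup_tree c(3) 1)+, simp)
  qed (use c d e in simp)
qed

text \<open>A nonempty list needs no unpacking: it has the tree of its head paired with its tail, so
  moving \<open>x\<close> to the top and pushing a 2 yields exactly the code of the triple on which
  the program for \<open>g\<close> runs.\<close>

lemma polytime_case_list:
  assumes "polytime l" "polytime f" "polytime (\<lambda>y. g (fst y) (fst (snd y)) (snd (snd y)))"
  shows "polytime (\<lambda>x. case l x of [] \<Rightarrow> f x | a # as \<Rightarrow> g x a as)"
proof -
  obtain c p where c: "wf_com c" "\<And>x. tsize (l x) \<le> poly p (tsize x)"
    "\<And>x A B C. runs c [code_of x @ A, B, C] (poly p (tsize x)) [code_of (l x) @ A, B, C]"
    using polytimeE[OF assms(1)] by blast
  obtain d q where d: "wf_com d" "\<And>x. tsize (f x) \<le> poly q (tsize x)"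
    "\<And>x A B C. runs d [code_of x @ A, B, C] (poly q (tsize x)) [code_of (f x) @ A, B, C]"
    using polytimeE[OF assms(2)] by blast
  let ?g = "\<lambda>y. g (fst y) (fst (snd y)) (snd (snd y))"
  obtain e r where e: "wf_com e" "\<And>x. tsize (?g x) \<le> poly r (tsize x)"
    "\<And>x A B C. runs e [code_of x @ A, B, C] (poly r (tsize x)) [code_of (?g x) @ A, B, C]"
    using polytimeE[OF assms(3)] by blast
  let ?h = "\<lambda>x. case l x of [] \<Rightarrow> f x | a # as \<Rightarrow> g x a as"
  let ?d = "Cond 0 (\<lambda>a. a = 1) (Pop 0 ;; d) (swap_tree ;; Push 0 2 ;; e)"
  let ?r = "pcompose r ([:1, 1:] + p)"
  have size: "poly r (tsize (x, a, as)) \<le> poly ?r (tsize x)" if "l x = a # as" for x a as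
    using c(2)[of x] that
    by (auto simp: poly_pcompose to_tree_prod_def intro!: poly_nat_mono)
  show ?thesis
  proof (rule polytimeI[of "dup_tree ;; c ;; ?d" _ "q + ?r" "[:51, 48:] + [:24:] * p + q + ?r"])
    fix x A B C
    show "tsize (?h x) \<le> poly (q + ?r) (tsize x)"
      using d(2)[of x] size[of x] e(2) by (fastforce split: list.split intro: order_trans trans_le_add2)
    have 1: "runs ?d [code_of (l x) @ code_of x @ A, B, C]
        (33 + 23 * tsize x + 23 * poly p (tsize x) + poly q (tsize x) + poly ?r (tsize x))
        [code_of (?h x) @ A, B, C]"
    proof (cases "l x")
      case Nil
      have "runs (Pop 0 ;; d) [1 # code_of x @ A, B, C]
         (1 + poly q (tsize x)) [code_of (f x) @ A, B, C]"
        by (rule runs_Seq runs_Pop3 d(3))+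
      from runs_mono[OF runs_Cond3_True[OF this, of "\<lambda>a. a = 1" "swap_tree ;; Push 0 2 ;; e"],
          of "33 + 23 * tsize x + 23 * poly p (tsize x) + poly q (tsize x) + poly ?r (tsize x)"] Nil
      show ?thesis by simp
    next
      case (Cons a as)
      have *: "code_of (x, a, as) = 2 # code_of x @ code_of (l x)"
        by (simp add: to_tree_prod_def Cons)
      have "runs (swap_tree ;; Push 0 2 ;; e) [code_of (l x) @ code_of x @ A, B, C]
         ((23 * (tsize (l x) + tsize x) + 28) + (2 + poly r (tsize (x, a, as))))
         [code_of (g x a as) @ A, B, C]"
        using e(3)[of "(x, a, as)" A B C] unfolding *
        by - ((rule runs_Seq runs_swap_tree runs_Push3)+, simp)
      moreover have "23 * (tsize (l x) + tsize x) + 28 + (2 + poly r (tsize (x, a, as))) + 1 \<le>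
          33 + 23 * tsize x + 23 * poly p (tsize x) + poly q (tsize x) + poly ?r (tsize x)"
        using size[OF Cons] c(2)[of x] by simp
      ultimately show ?thesis
        using runs_mono[OF runs_Cond3_False[of _ 2 "code_of a @ code_of as @ code_of x @ A" B C _ _ "\<lambda>a. a = 1"]]
          Cons by simp
    qed
    show "runs (dup_tree ;; c ;; ?d) [code_of x @ A, B, C] (poly ([:51, 48:] + [:24:] * p + q + ?r) (tsize x))
        [code_of (?h x) @ A, B, C]"
      by (rule runs_mono, (rule runs_Seq runs_dup_tree c(3) 1)+, simp)
  qed (use c d e in simp)
qed

lemma length_le_tsize: "length xs < tsize xs"
  by (induction xs) (auto simp: Suc_le_eq)

text \<open>The list is a clock: each round discards one element, and the code of the empty list, a
  1, stops the loop. The bound is demanded of all iterates, since the running time of every round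
  depends on the value reached there.\<close>

lemma polytime_funpow:
  fixes l :: "'a::encodable \<Rightarrow> 'b::encodable list" and h :: "'c::encodable \<Rightarrow> 'c" and r :: "nat poly"
  assumes "polytime l" "polytime a" "polytime h"
    and bound: "\<And>x i. i \<le> length (l x) \<Longrightarrow> tsize ((h ^^ i) (a x)) \<le> poly r (tsize x)"
  shows "polytime (\<lambda>x. (h ^^ length (l x)) (a x))"
proof -
  obtain c p where c: "wf_com c" "\<And>x. tsize (l x, a x) \<le> poly p (tsize x)"
    "\<And>x A B C. runs c [code_of x @ A, B, C] (poly p (tsize x)) [code_of (l x, a x) @ A, B, C]"
    using polytimeE[OF polytime_Pair[OF assms(1,2)]] by blast
  obtain d q where d: "wf_com d" "\<And>x. tsize (h x) \<le> poly q (tsize x)"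
    "\<And>x A B C. runs d [code_of x @ A, B, C] (poly q (tsize x)) [code_of (h x) @ A, B, C]"
    using polytimeE[OF assms(3)] by blast
  \<comment> \<open>The rest of the clock lies above the accumulator: it is put aside on stack 1
    while \<open>h\<close> is applied, then moved back.\<close>
  let ?b = "Pop 0 ;; drop_tree ;; shift_tree ;; d ;; move_until_marker 1 0"
  let ?l = "Loop 0 (\<lambda>a. a = 2) ?b"
  \<comment> \<open>\<open>L\<close> and \<open>K\<close> are uniform over all rounds: the clock
    only shrinks, and \<open>K\<close> bounds the time of each application of \<open>h\<close>.
    Handling the clock costs at most \<open>19 * L + 19\<close> per round.\<close>
  have loop: "runs ?l [code_of xs @ code_of y @ A, B, C]
      (length xs * (19 * L + 19 + K) + 1) [1 # code_of ((h ^^ length xs) y) @ A, B, C]"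
    if "tsize xs \<le> L" "\<And>i. i \<le> length xs \<Longrightarrow> poly q (tsize ((h ^^ i) y)) \<le> K"
    for xs :: "'b list" and y A B C L K
    using that
  proof (induction xs arbitrary: y)
    case Nil
    show ?case
      using runs_Loop_False[of 0 "[1 # code_of y @ A, B, C]" "\<lambda>a. a = 2"] by simp
  next
    case (Cons x xs)
    have 1: "runs ?b [2 # code_of x @ code_of xs @ code_of y @ A, B, C]
        (1 + ((6 * tsize x + 6) + ((8 * tsize xs + 8) + (poly q (tsize y) + (5 * tsize xs + 2)))))
        [code_of xs @ code_of (h y) @ A, B, C]"
      by (rule runs_Seq runs_Pop3 runs_drop_tree runs_shift_tree d(3) runs_move_tree)+
    have 2: "runs ?l [code_of xs @ code_of (h y) @ A, B, C] (length xs * (19 * L + 19 + K) + 1)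
        [1 # code_of ((h ^^ length xs) (h y)) @ A, B, C]"
    proof (rule Cons.IH)
      show "tsize xs \<le> L" using Cons.prems(1) by simp
      show "poly q (tsize ((h ^^ i) (h y))) \<le> K" if "i \<le> length xs" for i
        using Cons.prems(2)[of "Suc i"] that by (simp add: funpow_swap1)
    qed
    have "poly q (tsize y) \<le> K"
      using Cons.prems(2)[of 0] by simp
    then have "1 + ((6 * tsize x + 6) + ((8 * tsize xs + 8) + (poly q (tsize y) + (5 * tsize xs + 2)))) +
        (length xs * (19 * L + 19 + K) + 1) + 2 \<le> length (x # xs) * (19 * L + 19 + K) + 1"
      using Cons.prems(1) by simp
    from runs_mono[OF runs_Loop_True[OF _ _ 1 2] this]
    show ?case by (simp add: funpow_swap1)
  qed
  let ?K = "pcompose q r"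
  show ?thesis
  proof (rule polytimeI[of "c ;; Pop 0 ;; ?l ;; Pop 0" _ r "p + [:3:] + p * ([:19:] * p + [:19:] + ?K)"])
    fix x A B C
    show "tsize ((h ^^ length (l x)) (a x)) \<le> poly r (tsize x)"
      by (rule bound) simp
    let ?L = "poly p (tsize x)"
    have L: "tsize (l x) \<le> ?L"
      using c(2)[of x] by (simp add: to_tree_prod_def)
    then have len: "length (l x) \<le> ?L"
      using length_le_tsize[of "l x"] by simp
    have 1: "runs ?l [code_of (l x) @ code_of (a x) @ A, B, C]
        (length (l x) * (19 * ?L + 19 + poly ?K (tsize x)) + 1)
        [1 # code_of ((h ^^ length (l x)) (a x)) @ A, B, C]"
      by (rule loop[OF L]) (auto simp: poly_pcompose intro: poly_nat_mono bound)
    have 2: "runs c [code_of x @ A, B, C] (poly p (tsize x))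
        [2 # code_of (l x) @ code_of (a x) @ A, B, C]"
      using c(3)[of x A B C] by (simp add: to_tree_prod_def)
    have "?L + (1 + ((length (l x) * (19 * ?L + 19 + poly ?K (tsize x)) + 1) + 1)) \<le>
        poly (p + [:3:] + p * ([:19:] * p + [:19:] + ?K)) (tsize x)"
      using mult_right_mono[OF len, of "19 * ?L + 19 + poly ?K (tsize x)"]
      by (simp add: algebra_simps)
    then show "runs (c ;; Pop 0 ;; ?l ;; Pop 0) [code_of x @ A, B, C]
       (poly (p + [:3:] + p * ([:19:] * p + [:19:] + ?K)) (tsize x))
       [code_of ((h ^^ length (l x)) (a x)) @ A, B, C]"
      by (rule runs_mono[rotated]) (rule runs_Seq 1 2 runs_Pop3)+
  qed (use c d in simp)
qed

section \<open>From programs on trees to machines deciding languages\<close>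

definition load_input :: com where
  "load_input = Loop 0 (\<lambda>a. a \<noteq> 0) (Copy 0 1 ;; Pop 0) ;; Push 0 1 ;;
     Loop 1 (\<lambda>a. a \<noteq> 0)
       (Cond 1 (\<lambda>a. a = 1) (Push 0 1) (Push 0 1 ;; Push 0 1 ;; Push 0 2) ;; Push 0 2 ;; Pop 1)"

text \<open>The first pass reverses the input onto stack 1, so that its last bit comes first and the
  list can be built from its end, on top of a leaf. Both passes stop at the blank that is read from
  an empty stack.\<close>

lemma runs_load_input:
  "runs load_input [map (\<lambda>b. if b then 2 else 1) x, [], []] (18 * length x + 4) [code_of x, [], []]"
proof -
  let ?f = "\<lambda>b. if b then 2 else (1::nat)"
  have 1: "runs (Loop 0 (\<lambda>a. a \<noteq> 0) (Copy 0 1 ;; Pop 0)) [map ?f x, B, []] (5 * length x + 1)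
      [[], rev (map ?f x) @ B, []]" for B
  proof (induction x arbitrary: B)
    case Nil
    show ?case using runs_Loop_False[of 0 "[[], B, []]" "\<lambda>a. a \<noteq> 0"] by simp
  next
    case (Cons b x)
    have 1: "runs (Copy 0 1 ;; Pop 0) [?f b # map ?f x, B, []] (2 + 1) [map ?f x, ?f b # B, []]"
      by (rule runs_Seq runs_Copy3 runs_Pop3)+
    from runs_mono[OF runs_Loop_True[OF _ _ 1 Cons.IH], of "5 * length (b # x) + 1"]
    show ?case by simp
  qed
  have 2: "runs (Loop 1 (\<lambda>a. a \<noteq> 0)
       (Cond 1 (\<lambda>a. a = 1) (Push 0 1) (Push 0 1 ;; Push 0 1 ;; Push 0 2) ;; Push 0 2 ;; Pop 1))
      [code_of y, map ?f (rev z), []] (12 * length z + 1) [code_of (z @ y), [], []]" for y z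
  proof (induction z arbitrary: y rule: rev_induct)
    case Nil
    show ?case using runs_Loop_False[of 1 "[code_of y, [], []]" "\<lambda>a. a \<noteq> 0"] by simp
  next
    case (snoc b z)
    let ?c = "Cond 1 (\<lambda>a. a = 1) (Push 0 1) (Push 0 1 ;; Push 0 1 ;; Push 0 2)"
    have c: "runs ?c [code_of y, ?f b # map ?f (rev z), []] 7
        [code_of b @ code_of y, ?f b # map ?f (rev z), []]"
    proof (cases b)
      case True
      have "runs (Push 0 1 ;; Push 0 1 ;; Push 0 2) [code_of y, ?f b # map ?f (rev z), []] (2 + (2 + 2))
        [2 # 1 # 1 # code_of y, ?f b # map ?f (rev z), []]"
        by (rule runs_Seq runs_Push3)+
      from runs_Cond_False[OF this, of 1 "\<lambda>a. a = 1" "Push 0 1"] True show ?thesis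
        by (simp add: to_tree_bool_def)
    next
      case False
      have "runs (Push 0 1) [code_of y, ?f b # map ?f (rev z), []] 2
        [1 # code_of y, ?f b # map ?f (rev z), []]"
        by (rule runs_Push3)
      from runs_mono[OF runs_Cond_True[OF this, of 1 "\<lambda>a. a = 1" "Push 0 1 ;; Push 0 1 ;; Push 0 2"], of 7] False
      show ?thesis
        by (simp add: to_tree_bool_def)
    qed
    have "runs (?c ;; Push 0 2 ;; Pop 1) [code_of y, ?f b # map ?f (rev z), []] (7 + (2 + 1))
       [2 # code_of b @ code_of y, map ?f (rev z), []]"
      by (rule runs_Seq c runs_Push3 runs_Pop3)+
    then have 1: "runs (?c ;; Push 0 2 ;; Pop 1) [code_of y, ?f b # map ?f (rev z), []] 10
       [code_of (b # y), map ?f (rev z), []]" by simp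
    from runs_mono[OF runs_Loop_True[OF _ _ 1 snoc.IH], of "12 * length (z @ [b]) + 1"]
    show ?case by simp
  qed
  have "runs load_input [map ?f x, [], []] ((5 * length x + 1) + (2 + (12 * length x + 1))) [code_of x, [], []]"
    unfolding load_input_def
    by (rule runs_Seq, rule 1, rule runs_Seq, rule runs_Push3) (use 2[of "[]" x] in \<open>simp add: rev_map\<close>)
  then show ?thesis by (rule runs_mono) simp
qed

lemma wf_load_input: "wf_com load_input"
  by (simp add: load_input_def)

text \<open>State 0 only enters the program at state 3. The exit state \<open>3 + code_len c\<close>
  reads the top of stack 0, which tells the codes of \<open>True\<close> and \<open>False\<close>
  apart.\<close>

definition tm_of :: "com \<Rightarrow> tm" where
  "tm_of c = \<lparr>tm_tapes = 3, tm_symbols = 4, tm_states = code_len c + 4,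
     tm_delta = (\<lambda>q rs. if q < 3 then (3, stay rs) else if q < 3 + code_len c then code c 3 q rs
       else (if rs ! 0 = 2 then 1 else 2, stay rs))\<rparr>"

lemma wf_tm_of:
  assumes "wf_com c"
  shows "wf_tm (tm_of c)"
proof -
  have "fst (tm_delta (tm_of c) q rs) < code_len c + 4 \<and> length (snd (tm_delta (tm_of c) q rs)) = 3 \<and>
      fst ` set (snd (tm_delta (tm_of c) q rs)) \<subseteq> {..<4}"
    if rs: "length rs = 3" "set rs \<subseteq> {..<4}" for q rs
  proof (cases "3 \<le> q \<and> q < 3 + code_len c")
    case True
    then show ?thesis using code_wf[OF assms _ _ rs, of 3 q] by (simp add: tm_of_def)
  next
    case False
    then show ?thesis using rs stay_symbols[OF rs(2)] by (auto simp: tm_of_def)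
  qed
  then show ?thesis
    by (simp add: wf_tm_def case_prod_unfold) (simp add: tm_of_def)
qed

lemma tm_step_halting: "halting (fst c) \<Longrightarrow> (tm_step M ^^ k) c = c"
  by (induction k) (auto simp: tm_step_def case_prod_unfold)

lemma stack_on_input: "stack_on (input_tape x) (map (\<lambda>b. if b then 2 else 1) x)"
  by (auto simp: stack_on_def input_tape_def)

lemma stack_on_blank: "stack_on blank_tape []"
  by (simp add: stack_on_def blank_tape_def)

lemma tsize_bool_list: "tsize (x :: bool list) \<le> 1 + 4 * length x"
  by (induction x) (auto simp: to_tree_bool_def)

theorem polytime_class_P:
  assumes "polytime (f :: bool list \<Rightarrow> bool)"
  shows "{x. f x} \<in> class_P"
proof -
  obtain c p where c: "wf_com c" "\<And>x. tsize (f x) \<le> poly p (tsize x)"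
    "\<And>x A B C. runs c [code_of x @ A, B, C] (poly p (tsize x)) [code_of (f x) @ A, B, C]"
    using polytimeE[OF assms] by blast
  let ?c = "load_input ;; c"
  let ?M = "tm_of ?c"
  \<comment> \<open>Loading takes at most \<open>18 * n + 4\<close> steps for an input of length
    \<open>n\<close>, and 2 more enter and leave the program. \<open>[:1, 4:]\<close> bounds the
    size of the input as a tree.\<close>
  let ?p = "[:6, 18:] + pcompose p [:1, 4:]"
  have hosts: "hosts ?M 3 ?c"
    by (auto simp: hosts_def tm_of_def)
  have "fst (tm_run ?M (poly ?p (length x)) x) = (if f x then 1 else 2)" for x
  proof -
    have run: "runs ?c [map (\<lambda>b. if b then 2 else 1) x, [], []]
        (18 * length x + 4 + poly p (tsize x)) [code_of (f x), [], []]"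
      using runs_Seq[OF runs_load_input, of c x] c(3)[of x "[]" "[]" "[]"] by simp
    have "list_all2 stack_on [input_tape x, blank_tape, blank_tape]
        [map (\<lambda>b. if b then 2 else 1) x, [], []]"
      by (simp add: stack_on_input stack_on_blank)
    from runsD[OF run hosts this] obtain t ts where
      t: "t \<le> 18 * length x + 4 + poly p (tsize x)"
      "(tm_step ?M ^^ t) (3, [input_tape x, blank_tape, blank_tape]) = (3 + code_len ?c, ts)"
      "list_all2 stack_on ts [code_of (f x), [], []]" by blast
    let ?end = "(if f x then 1 else 2, ts) :: config"
    have "(tm_step ?M ^^ 1) (tm_init ?M x) = (3, [input_tape x, blank_tape, blank_tape])"
      by (simp add: tm_init_def tm_step_def halting_def tm_of_def stay_def numeral_3_eq_3
          case_prod_unfold)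
    moreover have "map tape_read ts ! 0 = (if f x then 2 else 1)"
      using reads_stacks[OF t(3)] by (auto simp: to_tree_bool_def)
    then have "(tm_step ?M ^^ 1) (3 + code_len ?c, ts) = ?end"
      by (simp add: tm_step_working) (simp add: tm_of_def)
    ultimately have *: "(tm_step ?M ^^ (1 + (t + 1))) (tm_init ?M x) = ?end"
      by (intro funpow_trans[OF _ funpow_trans[OF t(2)]])
    have "poly p (tsize x) \<le> poly p (1 + 4 * length x)"
      by (rule poly_nat_mono[OF tsize_bool_list])
    then have "1 + (t + 1) \<le> poly ?p (length x)"
      using t(1) by (simp add: poly_pcompose algebra_simps)
    \<comment> \<open>The state is inspected after exactly \<open>poly ?p (length x)\<close> steps;
      the \<open>k\<close> steps left over are spent in the halting configuration.\<close>
    then obtain k where k: "poly ?p (length x) = (1 + (t + 1)) + k"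
      by (metis le_Suc_ex)
    have "tm_run ?M (poly ?p (length x)) x = ?end"
      unfolding tm_run_def k by (rule funpow_trans[OF * tm_step_halting]) (simp add: halting_def)
    then show ?thesis by simp
  qed
  then have "decides_in_time ?M {x. f x} (poly ?p)"
    by (simp add: decides_in_time_def)
  moreover have "wf_tm ?M"
    using c(1) wf_load_input by (intro wf_tm_of) simp
  ultimately show ?thesis
    unfolding class_P_def by blast
qed

section \<open>List functions\<close>

lemma polytime_size: "polytime f \<Longrightarrow> \<exists>p :: nat poly. \<forall>x. tsize (f x) \<le> poly p (tsize x)"
  unfolding polytime_def by blast

lemma polytime_fst_comp:
  "polytime f \<Longrightarrow> polytime (\<lambda>x. fst (f x))"
  by (rule polytime_comp[OF _ polytime_fst])

lemma polytime_snd_comp: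
  "polytime f \<Longrightarrow> polytime (\<lambda>x. snd (f x))"
  by (rule polytime_comp[OF _ polytime_snd])

lemma polytime_comp2:
  assumes "polytime (\<lambda>p. h (fst p) (snd p))" "polytime f" "polytime g"
  shows "polytime (\<lambda>x. h (f x) (g x))"
  using polytime_comp[OF polytime_Pair[OF assms(2,3)] assms(1)] by simp

lemma polytime_comp3:
  assumes "polytime (\<lambda>p. h (fst p) (fst (snd p)) (snd (snd p)))" "polytime e" "polytime f" "polytime g"
  shows "polytime (\<lambda>x. h (e x) (f x) (g x))"
  using polytime_comp[OF polytime_Pair[OF assms(2) polytime_Pair[OF assms(3,4)]] assms(1)] by simp

lemma polytime_Cons: "polytime f \<Longrightarrow> polytime g \<Longrightarrow> polytime (\<lambda>x. f x # g x)"
  by (rule polytime_retype[OF polytime_Pair]) (auto simp: to_tree_prod_def)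

lemma polytime_not: "polytime f \<Longrightarrow> polytime (\<lambda>x. \<not> f x)"
  by (drule polytime_If[OF _ polytime_const[of False] polytime_const[of True]], erule polytime_retype) simp

lemma polytime_conj: "polytime f \<Longrightarrow> polytime g \<Longrightarrow> polytime (\<lambda>x. f x \<and> g x)"
  by (drule (1) polytime_If[OF _ _ polytime_const[of False]], erule polytime_retype) simp

lemma polytime_disj: "polytime f \<Longrightarrow> polytime g \<Longrightarrow> polytime (\<lambda>x. f x \<or> g x)"
  by (drule (1) polytime_If[OF _ polytime_const[of True]], erule polytime_retype) simp

lemma polytime_eq_bool:
  assumes "polytime f" "polytime g"
  shows "polytime (\<lambda>x. f x = (g x :: bool))"
  using polytime_If[OF assms polytime_not[OF assms(2)]] by (rule polytime_retype) simp

text \<open>All rules speak of argument functions of one common \<open>x\<close>, so backward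
  application decomposes a term along its structure.\<close>

lemmas polytime_rules = polytime_id polytime_fst_comp polytime_snd_comp polytime_Pair polytime_Cons
  polytime_If polytime_case_list polytime_conj polytime_disj polytime_not polytime_eq_bool polytime_const

lemma tsize_bool: "tsize (b :: bool) \<le> 3"
  by (simp add: to_tree_bool_def)

lemma tsize_Pair [simp]: "tsize (a, b) = Suc (tsize a + tsize b)"
  by (simp add: to_tree_prod_def)

lemma tsize_drop: "tsize (drop n xs) \<le> tsize xs"
proof (induction xs arbitrary: n)
  case (Cons x xs)
  from Cons[of "n - 1"] show ?case by (cases n) auto
qed simp

lemma tsize_member: "a \<in> set xs \<Longrightarrow> tsize a < tsize xs"
  by (induction xs) auto

lemma tsize_append: "tsize (xs @ ys) + 1 = tsize xs + tsize ys"
  by (induction xs) auto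

text \<open>The bound on the growth of the accumulator cannot be dropped: a step that doubles the
  accumulator would make the fold exponential.\<close>

lemma polytime_fold:
  fixes l :: "'a::encodable \<Rightarrow> 'b::encodable list" and i :: "'a \<Rightarrow> 'c::encodable"
  assumes l: "polytime l" and i: "polytime i"
    and h: "polytime (\<lambda>y. h (fst y) (fst (snd y)) (snd (snd y)))"
    and growth: "\<And>x a c. a \<in> set (l x) \<Longrightarrow> tsize (h x a c) \<le> tsize c + poly q (tsize x)"
  shows "polytime (\<lambda>x. fold (h x) (l x) (i x))"
proof -
  \<comment> \<open>The parameter \<open>x\<close> travels along because \<open>h\<close> depends on
    it, while \<open>polytime_funpow\<close> iterates one fixed function.\<close>
  define step where "step s = (case fst (snd s) of [] \<Rightarrow> s | a # as \<Rightarrow> (fst s, as, h (fst s) a (snd (snd s))))"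
    for s :: "'a \<times> 'b list \<times> 'c"
  have step: "polytime step"
    unfolding step_def by (intro polytime_rules polytime_comp3[OF h])
  have iter: "(step ^^ k) (x, as, c) = (x, drop k as, fold (h x) (take k as) c)" if "k \<le> length as" for x as c k
    using that
  proof (induction k)
    case (Suc k)
    then have "drop k as = as ! k # drop (Suc k) as" "take (Suc k) as = take k as @ [as ! k]"
      by (simp_all add: Cons_nth_drop_Suc take_Suc_conv_app_nth)
    then show ?case using Suc by (simp add: step_def del: take_Suc)
  qed simp
  obtain p where p: "\<And>x. tsize (l x, i x) \<le> poly p (tsize x)"
    using polytime_size[OF polytime_Pair[OF l i]] by blast
  have fold_size: "tsize (fold (h x) as c) \<le> tsize c + length as * poly q (tsize x)"
    if "set as \<subseteq> set (l x)" for x as c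
    using that
  proof (induction as arbitrary: c)
    case (Cons a as)
    from Cons.prems growth[of a x c] Cons.IH[of "h x a c"] show ?case by simp
  qed simp
  \<comment> \<open>\<open>[:2, 1:]\<close> accounts for the two pair nodes and \<open>x\<close>,
    \<open>p\<close> for the list and the initial accumulator, and \<open>p * q\<close> for at most
    \<open>p\<close> rounds of growth by \<open>q\<close>.\<close>
  have bound: "tsize ((step ^^ k) (x, l x, i x)) \<le> poly ([:2, 1:] + p + p * q) (tsize x)"
    if "k \<le> length (l x)" for x k
  proof -
    let ?n = "tsize x"
    have "length (take k (l x)) \<le> poly p ?n"
      using length_le_tsize[of "l x"] p[of x] by simp
    then have "length (take k (l x)) * poly q ?n \<le> poly p ?n * poly q ?n"
      by (rule mult_right_mono) simp
    then have "tsize (fold (h x) (take k (l x)) (i x)) \<le> tsize (i x) + poly p ?n * poly q ?n"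
      using fold_size[OF set_take_subset[of k "l x"], of "i x"] by linarith
    moreover have "tsize (drop k (l x)) \<le> tsize (l x)"
      by (rule tsize_drop)
    ultimately show ?thesis
      using iter[OF that, of x "i x"] p[of x] by simp
  qed
  have "polytime (\<lambda>x. snd (snd ((step ^^ length (l x)) (x, l x, i x))))"
    by (intro polytime_snd_comp polytime_funpow[OF l _ step bound] polytime_Pair polytime_id l i) simp
  then show ?thesis by (simp add: iter)
qed

lemma polytime_rev: "polytime l \<Longrightarrow> polytime (\<lambda>x. rev (l x))"
proof -
  assume l: "polytime l"
  obtain p where p: "\<And>x. tsize (l x) \<le> poly p (tsize x)"
    using polytime_size[OF l] by blast
  have "polytime (\<lambda>x. fold (\<lambda>a c. a # c) (l x) [])"
  proof (rule polytime_fold[OF l, where q = p])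
    show "tsize (a # c) \<le> tsize c + poly p (tsize x)" if "a \<in> set (l x)" for x a c
      using tsize_member[OF that] p[of x] by simp
  qed (intro polytime_rules)+
  then show ?thesis by (simp add: fold_Cons_rev)
qed

lemma polytime_foldr:
  fixes l :: "'a::encodable \<Rightarrow> 'b::encodable list" and i :: "'a \<Rightarrow> 'c::encodable"
  assumes "polytime l" "polytime i" "polytime (\<lambda>y. h (fst y) (fst (snd y)) (snd (snd y)))"
    "\<And>x a c. a \<in> set (l x) \<Longrightarrow> tsize (h x a c) \<le> tsize c + poly q (tsize x)"
  shows "polytime (\<lambda>x. foldr (h x) (l x) (i x))"
  using polytime_fold[OF polytime_rev[OF assms(1)] assms(2,3), of q] assms(4) by (simp add: foldr_conv_fold)

lemma polytime_filter:
  assumes l: "polytime l" and P: "polytime (\<lambda>y. P (fst y) (snd y))"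
  shows "polytime (\<lambda>x. filter (P x) (l x))"
proof -
  obtain p where p: "\<And>x. tsize (l x) \<le> poly p (tsize x)"
    using polytime_size[OF l] by blast
  have "polytime (\<lambda>x. foldr (\<lambda>a c. if P x a then a # c else c) (l x) [])"
  proof (rule polytime_foldr[OF l, where q = p])
    show "tsize (if P x a then a # c else c) \<le> tsize c + poly p (tsize x)" if "a \<in> set (l x)" for x a c
      using tsize_member[OF that] p[of x] by simp
  qed (intro polytime_rules polytime_comp2[OF P])+
  moreover have "foldr (\<lambda>a c. if P x a then a # c else c) as [] = filter (P x) as" for x as
    by (induction as) auto
  ultimately show ?thesis by simp
qed

lemma polytime_map:
  assumes l: "polytime l" and f: "polytime (\<lambda>y. f (fst y) (snd y))"
  shows "polytime (\<lambda>x. map (f x) (l x))"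
proof -
  obtain p where p: "\<And>x. tsize (l x) \<le> poly p (tsize x)"
    using polytime_size[OF l] by blast
  obtain q where q: "\<And>y. tsize (f (fst y) (snd y)) \<le> poly q (tsize y)"
    using polytime_size[OF f] by blast
  let ?q = "[:1:] + pcompose q ([:1, 1:] + p)"
  have "polytime (\<lambda>x. foldr (\<lambda>a c. f x a # c) (l x) [])"
  proof (rule polytime_foldr[OF l, where q = ?q])
    fix x a and c :: "'c list"
    assume "a \<in> set (l x)"
    from tsize_member[OF this] p[of x] have "tsize (x, a) \<le> poly ([:1, 1:] + p) (tsize x)"
      by simp
    from poly_nat_mono[OF this, of q] q[of "(x, a)"]
    show "tsize (f x a # c) \<le> tsize c + poly ?q (tsize x)"
      by (simp add: poly_pcompose)
  qed (intro polytime_rules polytime_comp2[OF f])+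
  moreover have "foldr (\<lambda>a c. f x a # c) as [] = map (f x) as" for x as
    by (induction as) auto
  ultimately show ?thesis by simp
qed

lemma polytime_append:
  assumes "polytime f" "polytime g"
  shows "polytime (\<lambda>x. f x @ g x)"
proof -
  obtain p where p: "\<And>x. tsize (f x) \<le> poly p (tsize x)"
    using polytime_size[OF assms(1)] by blast
  have "polytime (\<lambda>x. foldr (\<lambda>a c. a # c) (f x) (g x))"
  proof (rule polytime_foldr[OF assms, where q = p])
    show "tsize (a # c) \<le> tsize c + poly p (tsize x)" if "a \<in> set (f x)" for x a c
      using tsize_member[OF that] p[of x] by simp
  qed (intro polytime_rules)
  moreover have "foldr (\<lambda>a c. a # c) as bs = as @ bs" for as bs :: "'b list"
    by (induction as) auto
  ultimately show ?thesis by simp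
qed

lemma polytime_concat:
  assumes "polytime f"
  shows "polytime (\<lambda>x. concat (f x))"
proof -
  obtain p where p: "\<And>x. tsize (f x) \<le> poly p (tsize x)"
    using polytime_size[OF assms] by blast
  have "polytime (\<lambda>x. foldr (\<lambda>a c. a @ c) (f x) [])"
  proof (rule polytime_foldr[OF assms, where q = p])
    show "tsize (a @ c) \<le> tsize c + poly p (tsize x)" if "a \<in> set (f x)" for x a c
      using tsize_member[OF that] p[of x] tsize_append[of a c] by simp
  qed (intro polytime_rules polytime_append)+
  moreover have "foldr (\<lambda>a c. a @ c) as [] = concat as" for as :: "'b list list"
    by (induction as) auto
  ultimately show ?thesis by simp
qed

lemma polytime_Ball:
  assumes l: "polytime l" and P: "polytime (\<lambda>y. P (fst y) (snd y))"
  shows "polytime (\<lambda>x. \<forall>a\<in>set (l x). P x a)"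
proof -
  have "polytime (\<lambda>x. foldr (\<lambda>a c. P x a \<and> c) (l x) True)"
    by (rule polytime_foldr[OF l, where q = "[:3:]"])
      (intro polytime_rules polytime_comp2[OF P] | simp add: tsize_bool trans_le_add2)+
  moreover have "foldr (\<lambda>a c. P x a \<and> c) as True = (\<forall>a\<in>set as. P x a)" for x as
    by (induction as) auto
  ultimately show ?thesis by simp
qed

lemma polytime_Bex:
  assumes "polytime l" "polytime (\<lambda>y. P (fst y) (snd y))"
  shows "polytime (\<lambda>x. \<exists>a\<in>set (l x). P x a)"
  using polytime_not[OF polytime_Ball[OF assms(1) polytime_not[OF assms(2)]]] by simp

text \<open>A fold over the first list consumes the second, kept in the accumulator with a flag. The
  flag stays false after a mismatch or if the second list runs out early; one that is too long
  leaves a nonempty rest.\<close>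

lemma polytime_eq_list:
  assumes eq: "polytime (\<lambda>p. fst p = (snd p :: 'a::encodable))"
  shows "polytime (\<lambda>p. fst p = (snd p :: 'a list))"
proof -
  let ?h = "\<lambda>a c. case snd c of [] \<Rightarrow> (False, []) | b # bs \<Rightarrow> (fst c \<and> a = b, bs)"
  have "polytime (\<lambda>p. fold ?h (fst p) (True, snd p :: 'a list))"
  proof (rule polytime_fold[where q = "[:3:]"])
    show "tsize (?h a c) \<le> tsize c + poly [:3:] (tsize p)" for p :: "'a list \<times> 'a list" and a c
      by (cases c; cases "snd c") (auto simp: to_tree_bool_def)
  qed (intro polytime_rules polytime_comp2[OF eq])+
  then have 1: "polytime (\<lambda>p. fst (fold ?h (fst p) (True, snd p :: 'a list)) \<and>
      (case snd (fold ?h (fst p) (True, snd p)) of [] \<Rightarrow> True | _ # _ \<Rightarrow> False))"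
    by (intro polytime_rules)
  have 2: "fst (fold ?h as (b, bs)) \<and> (case snd (fold ?h as (b, bs)) of [] \<Rightarrow> True | _ # _ \<Rightarrow> False)
      \<longleftrightarrow> b \<and> as = bs" for as bs b
  proof (induction as arbitrary: b bs)
    case Nil
    show ?case by (cases bs) simp_all
  next
    case (Cons a as)
    have *: "fold ?h (a # as) (b, bs) = fold ?h as (case bs of [] \<Rightarrow> (False, []) | b' # bs' \<Rightarrow> (b \<and> a = b', bs'))"
      by (cases bs) simp_all
    show ?case
    proof (cases bs)
      case Nil
      show ?thesis using Cons.IH[of False "[]"] by (simp only: * Nil list.case) simp
    next
      case (Cons b' bs')
      show ?thesis using Cons.IH[of "b \<and> a = b'" bs'] by (simp only: * Cons list.case) simp
    qed
  qed
  show ?thesis using 1 by (simp only: 2 simp_thms)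
qed

section \<open>Literals as pairs of a sign and a variable\<close>

primrec is_pos :: "'v literal \<Rightarrow> bool" where
  "is_pos (Pos v) = True"
| "is_pos (Neg v) = False"

text \<open>With this form, \<open>mk_lit (I v) v\<close> is the literal over \<open>v\<close> that
  \<open>I\<close> makes true, and \<open>mk_lit (\<not> I v) v\<close> the one it makes
  false.\<close>

definition mk_lit :: "bool \<Rightarrow> 'v \<Rightarrow> 'v literal" where
  "mk_lit b v = (if b then Pos v else Neg v)"

definition compl :: "'v literal \<Rightarrow> 'v literal" where
  "compl l = mk_lit (\<not> is_pos l) (lit_var l)"

instantiation literal :: (encodable) encodable
begin
definition to_tree_literal :: "'a literal \<Rightarrow> tree" where
  "to_tree_literal l = to_tree (is_pos l, lit_var l)"
instance ..
end

lemma polytime_literal_parts: "polytime (\<lambda>l. (is_pos l, lit_var l))"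
  by (rule polytime_retype[OF polytime_id]) (simp add: to_tree_literal_def)

lemma polytime_is_pos: "polytime f \<Longrightarrow> polytime (\<lambda>x. is_pos (f x))"
  using polytime_comp[OF _ polytime_comp[OF polytime_literal_parts polytime_fst]] by simp

lemma polytime_lit_var: "polytime f \<Longrightarrow> polytime (\<lambda>x. lit_var (f x))"
  using polytime_comp[OF _ polytime_comp[OF polytime_literal_parts polytime_snd]] by simp

lemma polytime_mk_lit: "polytime f \<Longrightarrow> polytime g \<Longrightarrow> polytime (\<lambda>x. mk_lit (f x) (g x))"
  by (drule (1) polytime_Pair, erule polytime_retype) (simp add: to_tree_literal_def mk_lit_def to_tree_prod_def)

lemma polytime_compl: "polytime f \<Longrightarrow> polytime (\<lambda>x. compl (f x))"
  unfolding compl_def by (intro polytime_rules polytime_mk_lit polytime_is_pos polytime_lit_var)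

lemma polytime_eq_word: "polytime f \<Longrightarrow> polytime g \<Longrightarrow> polytime (\<lambda>x. f x = (g x :: bool list))"
  by (rule polytime_comp2[OF polytime_eq_list]) (intro polytime_rules)+

lemma polytime_eq_literal:
  assumes "polytime f" "polytime g"
  shows "polytime (\<lambda>x. f x = (g x :: var literal))"
proof -
  have "l = m \<longleftrightarrow> is_pos l = is_pos m \<and> lit_var l = lit_var m" for l m :: "var literal"
    by (cases l; cases m) auto
  then show ?thesis
    using assms by (auto intro!: polytime_conj polytime_eq_bool polytime_eq_word polytime_is_pos polytime_lit_var)
qed

lemma polytime_member:
  assumes "polytime f" "polytime g"
  shows "polytime (\<lambda>x. f x \<in> set (g x :: var literal list))"
proof -
  have "polytime (\<lambda>x. \<exists>l\<in>set (g x). l = f x)"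
    by (intro polytime_Bex polytime_eq_literal assms polytime_rules polytime_comp[OF _ assms(1)])
  then show ?thesis by simp
qed

section \<open>Merging and unit propagation\<close>

lemma compl_compl [simp]: "compl (compl l) = l"
  by (cases l) (simp_all add: compl_def mk_lit_def)

lemma compl_mk_lit [simp]: "compl (mk_lit b v) = mk_lit (\<not> b) v"
  by (simp add: compl_def mk_lit_def)

lemma mk_lit_inject [simp]: "mk_lit b v = mk_lit b' v' \<longleftrightarrow> b = b' \<and> v = v'"
  by (simp add: mk_lit_def)

lemma lit_var_mk_lit [simp]: "lit_var (mk_lit b v) = v"
  by (simp add: mk_lit_def)

lemma lit_true_compl [simp]: "lit_true I (compl l) \<longleftrightarrow> \<not> lit_true I l"
  by (cases l) (simp_all add: compl_def mk_lit_def)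

lemma lit_true_mk_lit [simp]: "lit_true I (mk_lit b v) \<longleftrightarrow> I v = b"
  by (simp add: mk_lit_def)

lemma literal_cases: obtains b v where "l = mk_lit b v"
proof (cases l)
  case (Pos v)
  then show ?thesis using that[of True v] by (simp add: mk_lit_def)
next
  case (Neg v)
  then show ?thesis using that[of False v] by (simp add: mk_lit_def)
qed

definition consistent :: "'v literal list \<Rightarrow> bool" where
  "consistent K \<longleftrightarrow> (\<forall>l\<in>set K. compl l \<notin> set K)"

lemma consistent_iff: "models_conj K \<noteq> {} \<longleftrightarrow> consistent K"
proof
  assume "models_conj K \<noteq> {}"
  then show "consistent K"
    unfolding consistent_def models_conj_def using lit_true_compl by blast
next
  assume K: "consistent K"
  have "lit_true (\<lambda>v. Pos v \<in> set K) l" if "l \<in> set K" for l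
    using K that by (cases l) (auto simp: consistent_def compl_def mk_lit_def)
  then show "models_conj K \<noteq> {}"
    unfolding models_conj_def by blast
qed

lemma consistent_mk_lit: "consistent K \<Longrightarrow> mk_lit b v \<in> set K \<Longrightarrow> mk_lit (\<not> b) v \<notin> set K"
  by (metis compl_mk_lit consistent_def)

lemma models_conj_iff:
  assumes "vars_conj K \<subseteq> X"
  shows "I \<in> models_conj K \<longleftrightarrow> (\<forall>v\<in>X. mk_lit (\<not> I v) v \<notin> set K)"
proof
  assume "I \<in> models_conj K"
  then show "\<forall>v\<in>X. mk_lit (\<not> I v) v \<notin> set K"
    unfolding models_conj_def by fastforce
next
  assume *: "\<forall>v\<in>X. mk_lit (\<not> I v) v \<notin> set K"
  have "lit_true I l" if "l \<in> set K" for l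
  proof (cases l rule: literal_cases)
    case (1 b v)
    then have "v \<in> X" using that assms by (auto simp: vars_conj_def)
    then show ?thesis using * that 1 by (cases b; cases "I v") auto
  qed
  then show "I \<in> models_conj K" by (simp add: models_conj_def)
qed

text \<open>Every model of \<open>K\<close> differs from \<open>I\<close> wherever \<open>K\<close>
  contains the literal false under \<open>I\<close>, and by consistency flipping \<open>I\<close> at
  exactly these variables yields a model.\<close>

lemma hamming_models_conj:
  assumes X: "finite X" "vars_conj K \<subseteq> X" and K: "consistent K"
  shows "hamming_models X I (models_conj K) = card {v \<in> X. mk_lit (\<not> I v) v \<in> set K}"
  unfolding hamming_models_def
proof (rule Min_eqI)
  show "finite {hamming X I J |J. J \<in> models_conj K}"
    by (rule finite_subset[of _ "{..card X}"]) (auto simp: hamming_def X(1) card_mono)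
next
  fix d assume "d \<in> {hamming X I J |J. J \<in> models_conj K}"
  then obtain J where J: "J \<in> models_conj K" "d = hamming X I J" by blast
  have "I v \<noteq> J v" if "v \<in> X" "mk_lit (\<not> I v) v \<in> set K" for v
  proof -
    have "mk_lit (\<not> J v) v \<notin> set K"
      using J(1) that(1) unfolding models_conj_iff[OF X(2)] by blast
    then show ?thesis using that(2) by (cases "I v"; cases "J v") simp_all
  qed
  then have "{v \<in> X. mk_lit (\<not> I v) v \<in> set K} \<subseteq> {v \<in> X. I v \<noteq> J v}"
    by blast
  then show "card {v \<in> X. mk_lit (\<not> I v) v \<in> set K} \<le> d"
    unfolding J(2) hamming_def by (intro card_mono) (simp_all add: X(1))
next
  let ?J = "\<lambda>v. if mk_lit (\<not> I v) v \<in> set K then \<not> I v else I v"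
  have "?J \<in> models_conj K"
    unfolding models_conj_iff[OF X(2)]
  proof
    fix v
    show "mk_lit (\<not> ?J v) v \<notin> set K"
      using consistent_mk_lit[OF K, of "\<not> I v" v] by (cases "I v") auto
  qed
  moreover have "hamming X I ?J = card {v \<in> X. mk_lit (\<not> I v) v \<in> set K}"
    unfolding hamming_def by (rule arg_cong[of _ _ card]) auto
  ultimately show "card {v \<in> X. mk_lit (\<not> I v) v \<in> set K} \<in> {hamming X I J |J. J \<in> models_conj K}"
    by force
qed

text \<open>If some variable could be improved, flipping it alone would give a strictly smaller sum;
  conversely the sums compare term by term.\<close>

lemma separable_minimum_iff:
  fixes c :: "'v \<Rightarrow> bool \<Rightarrow> nat"
  assumes "finite X"
  shows "(\<forall>J. (\<Sum>v\<in>X. c v (I v)) \<le> (\<Sum>v\<in>X. c v (J v))) \<longleftrightarrow> (\<forall>v\<in>X. c v (I v) \<le> c v (\<not> I v))"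
proof
  assume min: "\<forall>J. (\<Sum>v\<in>X. c v (I v)) \<le> (\<Sum>v\<in>X. c v (J v))"
  show "\<forall>v\<in>X. c v (I v) \<le> c v (\<not> I v)"
  proof (rule ccontr)
    assume "\<not> ?thesis"
    then obtain u where u: "u \<in> X" "c u (\<not> I u) < c u (I u)" by auto
    let ?J = "I(u := \<not> I u)"
    have "(\<Sum>v\<in>X. c v (?J v)) < (\<Sum>v\<in>X. c v (I v))"
      using u by (intro sum_strict_mono_ex1 assms) (auto intro!: bexI[of _ u])
    with min show False by (meson not_less)
  qed
next
  assume *: "\<forall>v\<in>X. c v (I v) \<le> c v (\<not> I v)"
  show "\<forall>J. (\<Sum>v\<in>X. c v (I v)) \<le> (\<Sum>v\<in>X. c v (J v))"
  proof (intro allI sum_mono)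
    fix J v assume "v \<in> X"
    with * show "c v (I v) \<le> c v (J v)" by (cases "J v = I v") auto
  qed
qed

text \<open>Giving \<open>v\<close> the value \<open>b\<close> costs \<open>w1\<close> if
  \<open>K1\<close> contains the opposite literal, and \<open>w2\<close> if \<open>K2\<close> does.
  The weighted distance is the sum of these costs, so optimality splits by variable.\<close>

lemma merge_models_conj:
  assumes "finite X" "vars_conj K1 \<subseteq> X" "vars_conj K2 \<subseteq> X" "consistent K1" "consistent K2"
  shows "I \<in> merge_models X w1 w2 (models_conj K1) (models_conj K2) \<longleftrightarrow>
     (\<forall>v\<in>X. w1 * of_bool (mk_lit (\<not> I v) v \<in> set K1) + w2 * of_bool (mk_lit (\<not> I v) v \<in> set K2) \<le>
            w1 * of_bool (mk_lit (I v) v \<in> set K1) + w2 * of_bool (mk_lit (I v) v \<in> set K2))"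
proof -
  let ?c = "\<lambda>v b. w1 * of_bool (mk_lit (\<not> b) v \<in> set K1) + w2 * of_bool (mk_lit (\<not> b) v \<in> set K2)"
  have "weighted_dist X w1 w2 (models_conj K1) (models_conj K2) J = (\<Sum>v\<in>X. ?c v (J v))" for J
    using assms
    by (simp add: weighted_dist_def hamming_models_conj sum.distrib sum_of_bool_eq Int_def
        flip: sum_distrib_left)
  then show ?thesis
    using separable_minimum_iff[OF assms(1), of ?c I] by (simp add: merge_models_def)
qed

text \<open>The outcome if the weight of \<open>K1\<close> is the greater one.\<close>

definition prevail :: "'v literal list \<Rightarrow> 'v literal list \<Rightarrow> 'v literal list" where
  "prevail K1 K2 = K1 @ filter (\<lambda>l. compl l \<notin> set K1) K2"

text \<open>The outcome for equal weights: at a variable in conflict both values cost the same, so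
  it is left free.\<close>

definition undisputed :: "'v literal list \<Rightarrow> 'v literal list \<Rightarrow> 'v literal list" where
  "undisputed K1 K2 = filter (\<lambda>l. compl l \<notin> set K1 \<and> compl l \<notin> set K2) (K1 @ K2)"

lemma consistent_prevail: "consistent K1 \<Longrightarrow> consistent K2 \<Longrightarrow> consistent (prevail K1 K2)"
  by (auto simp: consistent_def prevail_def)

lemma consistent_undisputed: "consistent (undisputed K1 K2)"
  by (auto simp: consistent_def undisputed_def)

lemma merge_models_eq:
  assumes "finite X" "vars_conj K1 \<subseteq> X" "vars_conj K2 \<subseteq> X" "consistent K1" "consistent K2"
    and "w1 > 0" "w2 > 0"
  shows "merge_models X w1 w2 (models_conj K1) (models_conj K2) = models_conj
    (if w1 > w2 then prevail K1 K2 else if w1 < w2 then prevail K2 K1 else undisputed K1 K2)"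
    (is "_ = models_conj ?L")
proof -
  have vars: "vars_conj ?L \<subseteq> X"
    using assms(2,3) by (auto simp: vars_conj_def prevail_def undisputed_def)
  \<comment> \<open>A consistent conjunction has at most one literal over \<open>v\<close>. The
    value \<open>b\<close> fails to be optimal exactly if the opposition to it outweighs the
    support, so the weights matter only in a conflict.\<close>
  have key: "w1 * of_bool (mk_lit (\<not> b) v \<in> set K1) + w2 * of_bool (mk_lit (\<not> b) v \<in> set K2) \<le>
      w1 * of_bool (mk_lit b v \<in> set K1) + w2 * of_bool (mk_lit b v \<in> set K2) \<longleftrightarrow>
      mk_lit (\<not> b) v \<notin> set ?L" for b v
    using assms(6,7) consistent_mk_lit[OF assms(4), of b v] consistent_mk_lit[OF assms(5), of b v]
    by (auto simp: prevail_def undisputed_def of_bool_def)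
  show ?thesis
    by (rule set_eqI) (simp only: merge_models_conj[OF assms(1-5)] models_conj_iff[OF vars] key)
qed

lemma obtainable_iff:
  assumes "consistent K1" "consistent K2"
  shows "obtainable K1 K2 R \<longleftrightarrow> models_cnf R = models_conj (prevail K1 K2) \<or>
    models_cnf R = models_conj (prevail K2 K1) \<or> models_cnf R = models_conj (undisputed K1 K2)"
proof -
  let ?X = "vars_conj K1 \<union> vars_conj K2 \<union> vars_cnf R"
  have X: "finite ?X" "vars_conj K1 \<subseteq> ?X" "vars_conj K2 \<subseteq> ?X"
    by (auto simp: vars_conj_def vars_cnf_def)
  note merge = merge_models_eq[OF X assms]
  show ?thesis
  proof
    assume "obtainable K1 K2 R"
    then obtain w1 w2 where w: "w1 > 0" "w2 > 0"
      and R: "models_cnf R = merge_models ?X w1 w2 (models_conj K1) (models_conj K2)"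
      unfolding obtainable_def by blast
    show "models_cnf R = models_conj (prevail K1 K2) \<or>
      models_cnf R = models_conj (prevail K2 K1) \<or> models_cnf R = models_conj (undisputed K1 K2)"
      using R[unfolded merge[OF w]] by (cases "w1 > w2"; cases "w1 < w2") simp_all
  next
    assume "models_cnf R = models_conj (prevail K1 K2) \<or>
      models_cnf R = models_conj (prevail K2 K1) \<or> models_cnf R = models_conj (undisputed K1 K2)"
    \<comment> \<open>The weights 2 and 1, 1 and 2, 1 and 1 represent the three possible
      orders.\<close>
    then have "models_cnf R = merge_models ?X 2 1 (models_conj K1) (models_conj K2) \<or>
      models_cnf R = merge_models ?X 1 2 (models_conj K1) (models_conj K2) \<or>
      models_cnf R = merge_models ?X 1 1 (models_conj K1) (models_conj K2)"
      using merge[of 2 1] merge[of 1 2] merge[of 1 1] by simp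
    then show "obtainable K1 K2 R"
      unfolding obtainable_def by (metis zero_less_numeral zero_less_one)
  qed
qed

section \<open>Entailment between a formula and a conjunction of literals\<close>

definition clauses_follow :: "'v literal list \<Rightarrow> 'v cnf \<Rightarrow> bool" where
  "clauses_follow L R \<longleftrightarrow> (\<forall>C\<in>set R. \<exists>l\<in>set C. l \<in> set L \<or> compl l \<in> set C)"

lemma clauses_follow_iff:
  assumes "consistent L"
  shows "clauses_follow L R \<longleftrightarrow> models_conj L \<subseteq> models_cnf R"
proof
  assume R: "clauses_follow L R"
  show "models_conj L \<subseteq> models_cnf R"
  proof
    fix I assume I: "I \<in> models_conj L"
    have "\<exists>l\<in>set C. lit_true I l" if C: "C \<in> set R" for C
    proof -
      obtain l where "l \<in> set C" "l \<in> set L \<or> compl l \<in> set C"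
        using R C by (auto simp: clauses_follow_def)
      then show ?thesis
        using I lit_true_compl[of I l] unfolding models_conj_def by blast
    qed
    then show "I \<in> models_cnf R" by (simp add: models_cnf_def)
  qed
next
  assume sub: "models_conj L \<subseteq> models_cnf R"
  show "clauses_follow L R"
    unfolding clauses_follow_def
  proof (rule ballI, rule ccontr)
    fix C assume C: "C \<in> set R" and no: "\<not> (\<exists>l\<in>set C. l \<in> set L \<or> compl l \<in> set C)"
    \<comment> \<open>A countermodel: it obeys \<open>L\<close>, and at variables on which
      \<open>L\<close> is silent it falsifies the literals of \<open>C\<close>, which is possible
      since \<open>C\<close> is no tautology.\<close>
    let ?I = "\<lambda>v. mk_lit True v \<in> set L \<or> mk_lit False v \<notin> set L \<and> mk_lit False v \<in> set C"
    have "lit_true ?I l" if "l \<in> set L" for l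
    proof (cases l rule: literal_cases)
      case (1 b v)
      then show ?thesis using that consistent_mk_lit[OF assms, of b v] by (cases b) auto
    qed
    then have "?I \<in> models_cnf R" using sub by (auto simp: models_conj_def)
    then obtain l where l: "l \<in> set C" "lit_true ?I l" using C by (auto simp: models_cnf_def)
    then have "l \<notin> set L" "compl l \<notin> set C" using no by auto
    moreover obtain b v where "l = mk_lit b v" by (rule literal_cases)
    ultimately show False using l by (cases b) auto
  qed
qed

text \<open>The literal \<open>l\<close> may itself be contradicted by \<open>U\<close>. From a
  nonempty clause whose literals are all contradicted, each of them is derived, so such a conflict
  shows up as a complementary pair.\<close>

definition unit_derivable :: "'v cnf \<Rightarrow> 'v literal set \<Rightarrow> 'v literal \<Rightarrow> bool" where
  "unit_derivable R U l \<longleftrightarrow> (\<exists>C\<in>set R. l \<in> set C \<and> (\<forall>m\<in>set C. m = l \<or> compl m \<in> U))"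

definition propagate :: "'v cnf \<Rightarrow> 'v literal list \<Rightarrow> 'v literal list \<Rightarrow> 'v literal list" where
  "propagate R ls U = filter (\<lambda>l. l \<in> set U \<or> unit_derivable R (set U) l) ls"

text \<open>Each effective round adds a literal of \<open>l # concat R\<close>, so the length of this list bounds the
  number of rounds. Keeping the derived literals a sublist of it bounds their total size.\<close>

definition unit_closure :: "'v cnf \<Rightarrow> 'v literal \<Rightarrow> 'v literal list" where
  "unit_closure R l = fold (\<lambda>_. propagate R (l # concat R)) (l # concat R) [l]"

lemma fold_const: "fold (\<lambda>_. f) xs a = (f ^^ length xs) a"
  by (induction xs arbitrary: a) (simp_all add: funpow_swap1)

lemma unit_closure_start: "l \<in> set (unit_closure R l)"
proof -
  have "l \<in> set ((propagate R (l # concat R) ^^ n) [l])" for n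
    by (induction n) (auto simp: propagate_def)
  then show ?thesis unfolding unit_closure_def fold_const .
qed

lemma unit_closure_closed:
  assumes "unit_derivable R (set (unit_closure R l)) m"
  shows "m \<in> set (unit_closure R l)"
proof -
  let ?ls = "l # concat R"
  define S where "S k = set ((propagate R ?ls ^^ k) [l])" for k
  let ?g = "\<lambda>U. {m \<in> set ?ls. m \<in> U \<or> unit_derivable R U m}"
  have step: "S (Suc k) = ?g (S k)" for k
    by (auto simp: S_def propagate_def)
  have sub: "S k \<subseteq> set ?ls" for k
    by (cases k) (auto simp: step, simp add: S_def)
  then have inc: "S k \<subseteq> S (Suc k)" for k
    unfolding step by blast
  have fin: "finite (S k)" for k by (simp add: S_def)
  \<comment> \<open>Either each of the first \<open>k\<close> rounds has added a literal, or a fixed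
    point is reached, and a fixed point persists.\<close>
  have "k \<le> card (S k) \<or> S (Suc k) = S k" for k
  proof (induction k)
    case (Suc k)
    show ?case
    proof (cases "S (Suc k) = S k")
      case True
      then have "S (Suc (Suc k)) = S (Suc k)" using step[of k] step[of "Suc k"] by simp
      then show ?thesis by simp
    next
      case False
      then have "card (S k) < card (S (Suc k))"
        using inc[of k] fin by (intro psubset_card_mono) auto
      then show ?thesis using Suc False by simp
    qed
  qed simp
  then have "length ?ls \<le> card (S (length ?ls)) \<or> S (Suc (length ?ls)) = S (length ?ls)" .
  then have stable: "S (Suc (length ?ls)) = S (length ?ls)"
  proof
    \<comment> \<open>With that many literals the closure exhausts the candidates, so it is stable
      in this case too.\<close>
    assume "length ?ls \<le> card (S (length ?ls))"
    then have "card (set ?ls) \<le> card (S (length ?ls))"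
      using card_length[of ?ls] by linarith
    then have "S (length ?ls) = set ?ls"
      using sub by (intro card_seteq) auto
    then show ?thesis using sub[of "Suc (length ?ls)"] inc[of "length ?ls"] by (metis subset_antisym)
  qed
  have closure: "set (unit_closure R l) = S (length ?ls)"
    by (simp only: unit_closure_def fold_const S_def)
  have "m \<in> set ?ls"
    using assms by (auto simp: unit_derivable_def)
  then have "m \<in> ?g (S (length ?ls))"
    using assms unfolding closure by blast
  then show ?thesis
    unfolding closure using step stable by blast
qed

lemma unit_closure_sound:
  assumes "I \<in> models_cnf R" "lit_true I l" "m \<in> set (unit_closure R l)"
  shows "lit_true I m"
proof -
  have "\<forall>m\<in>set ((propagate R (l # concat R) ^^ n) [l]). lit_true I m" for n
  proof (induction n)
    case (Suc n)
    let ?U = "set ((propagate R (l # concat R) ^^ n) [l])"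
    have derived: "lit_true I m" if m: "unit_derivable R ?U m" for m
    proof -
      obtain C where C: "C \<in> set R" "\<forall>k\<in>set C. k = m \<or> compl k \<in> ?U"
        using m by (auto simp: unit_derivable_def)
      obtain k where "k \<in> set C" "lit_true I k"
        using C(1) assms(1) by (auto simp: models_cnf_def)
      then show ?thesis using C(2) Suc[rule_format, of "compl k"] by auto
    qed
    have "set (propagate R ls U) \<subseteq> set U \<union> {m. unit_derivable R (set U) m}" for ls U
      by (auto simp: propagate_def)
    then show ?case using Suc derived by (simp  only: funpow.simps comp_apply) blast
  qed (use assms(2) in simp)
  then show ?thesis
    using assms(3) unfolding unit_closure_def fold_const by blast
qed

definition refutes :: "'v cnf \<Rightarrow> 'v literal \<Rightarrow> bool" where
  "refutes R l \<longleftrightarrow> (\<exists>m\<in>set (unit_closure R l). compl m \<in> set (unit_closure R l))"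

lemma refutes_sound:
  "refutes R l \<Longrightarrow> I \<in> models_cnf R \<Longrightarrow> \<not> lit_true I l"
  using unit_closure_sound lit_true_compl unfolding refutes_def by blast

text \<open>Without a conflict, a Horn formula is satisfied by making exactly the derived positive literals
  true. For a Krom formula the derived literals can be superimposed on any model, since a clause
  containing the complement of a derived literal is satisfied by another derived literal.\<close>

lemma refutes_complete:
  assumes "horn R \<or> krom R" and sat: "I0 \<in> models_cnf R" and no: "\<not> refutes R l"
  shows "\<exists>I \<in> models_cnf R. lit_true I l"
proof -
  let ?U = "set (unit_closure R l)"
  have closed: "m \<in> ?U" if "C \<in> set R" "m \<in> set C" "\<And>k. k \<in> set C \<Longrightarrow> k \<noteq> m \<Longrightarrow> compl k \<in> ?U" for C m
    using that by (intro unit_closure_closed) (auto simp: unit_derivable_def)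
  have no_conflict: "compl m \<notin> ?U" if "m \<in> ?U" for m
    using no that by (auto simp: refutes_def)
  from assms(1) show ?thesis
  proof
    assume horn: "horn R"
    let ?I = "\<lambda>v. Pos v \<in> ?U"
    have U: "lit_true ?I m" if "m \<in> ?U" for m
      by (cases m) (use that no_conflict[OF that] in \<open>auto simp: compl_def mk_lit_def\<close>)
    have neg: "compl m \<in> ?U" if "\<not> lit_true ?I m" "\<not> is_pos m" for m
      using that by (cases m) (auto simp: compl_def mk_lit_def)
    have "\<exists>m\<in>set C. lit_true ?I m" if C: "C \<in> set R" for C
    proof (rule ccontr)
      assume "\<not> ?thesis"
      then have false: "\<not> lit_true ?I m" if "m \<in> set C" for m using that by blast
      \<comment> \<open>The model of \<open>R\<close> rules out an empty clause, from which nothing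
        would be derived.\<close>
      have "set C \<noteq> {}" using sat C by (auto simp: models_cnf_def)
      \<comment> \<open>\<open>m\<close> is the positive literal of \<open>C\<close>, or any literal
        if there is none. The others are negative and false, so their complements are derived and
        \<open>C\<close> yields \<open>m\<close>.\<close>
      then obtain m where m: "m \<in> set C" "is_pos m \<or> (\<forall>k\<in>set C. \<not> is_pos k)"
        by (metis all_not_in_conv)
      have "\<not> is_pos k" if k: "k \<in> set C" "k \<noteq> m" for k
      proof
        assume pos: "is_pos k"
        with m k(1) have "is_pos m" by blast
        with pos obtain u v where uv: "k = Pos u" "m = Pos v"
          by (cases k; cases m) auto
        have "finite (Pos -` set C)"
          by (rule finite_vimageI) (auto simp: inj_def)
        then have "card {u, v} \<le> card {v. Pos v \<in> set C}"
          using m(1) k(1) uv by (intro card_mono) (auto simp: vimage_def)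
        moreover have "card {v. Pos v \<in> set C} \<le> 1"
          using horn C by (simp add: horn_def)
        ultimately show False using k(2) uv by simp
      qed
      then have "m \<in> ?U"
        using closed[OF C m(1)] neg false by blast
      with U false m(1) show False by blast
    qed
    then have "?I \<in> models_cnf R" by (simp add: models_cnf_def)
    then show ?thesis using U unit_closure_start by blast
  next
    assume krom: "krom R"
    let ?I = "\<lambda>v. Pos v \<in> ?U \<or> Neg v \<notin> ?U \<and> I0 v"
    have U: "lit_true ?I m" if "m \<in> ?U" for m
      by (cases m) (use that no_conflict[OF that] in \<open>auto simp: compl_def mk_lit_def\<close>)
    have flipped: "compl m \<in> ?U" if "lit_true I0 m" "\<not> lit_true ?I m" for m
      using that by (cases m) (auto simp: compl_def mk_lit_def)
    have "\<exists>m\<in>set C. lit_true ?I m" if C: "C \<in> set R" for C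
    proof (rule ccontr)
      assume "\<not> ?thesis"
      then have false: "\<not> lit_true ?I m" if "m \<in> set C" for m using that by blast
      obtain m where m: "m \<in> set C" "lit_true I0 m" using sat C by (auto simp: models_cnf_def)
      have m': "compl m \<in> ?U" by (rule flipped[OF m(2) false[OF m(1)]])
      show False
      proof (cases "set C = {m}")
        case True
        then have "m \<in> ?U" using closed[OF C m(1)] by blast
        with U false m(1) show False by blast
      next
        case False
        with m(1) obtain k where k: "k \<in> set C" "k \<noteq> m" by blast
        have "card (set C) \<le> card {m, k}"
          using krom C k(2) by (simp add: krom_def numeral_2_eq_2)
        then have mk: "{m, k} = set C"
          using m(1) k(1) by (intro card_seteq) auto
        have "compl j \<in> ?U" if "j \<in> set C" "j \<noteq> k" for j
          using that m' unfolding mk[symmetric] by simp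
        then have "k \<in> ?U" by (rule closed[OF C k(1)])
        with U false k(1) show False by blast
      qed
    qed
    then have "?I \<in> models_cnf R" by (simp add: models_cnf_def)
    then show ?thesis using U unit_closure_start by blast
  qed
qed

definition equivalent :: "'v cnf \<Rightarrow> 'v literal list \<Rightarrow> bool" where
  "equivalent R L \<longleftrightarrow> clauses_follow L R \<and> (\<forall>l\<in>set L. refutes R (compl l))"

text \<open>From left to right soundness of propagation suffices. In the converse, consistency of
  \<open>L\<close> supplies the model of \<open>R\<close> that completeness asks for, so the
  procedure contains no satisfiability test for \<open>R\<close>.\<close>

lemma equivalent_iff:
  assumes "horn R \<or> krom R" "consistent L"
  shows "equivalent R L \<longleftrightarrow> models_cnf R = models_conj L"
proof
  assume R: "equivalent R L"
  have "lit_true I l" if "I \<in> models_cnf R" "l \<in> set L" for I l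
    using R refutes_sound[of R "compl l" I] that by (auto simp: equivalent_def)
  then have "models_cnf R \<subseteq> models_conj L"
    by (auto simp: models_conj_def)
  then show "models_cnf R = models_conj L"
    using R clauses_follow_iff[OF assms(2)] by (auto simp: equivalent_def)
next
  assume eq: "models_cnf R = models_conj L"
  then obtain I0 where I0: "I0 \<in> models_cnf R"
    using assms(2) consistent_iff by blast
  have "refutes R (compl l)" if "l \<in> set L" for l
    using refutes_complete[OF assms(1) I0, of "compl l"] that unfolding eq by (auto simp: models_conj_def)
  then show "equivalent R L"
    using eq clauses_follow_iff[OF assms(2)] by (auto simp: equivalent_def)
qed

text \<open>Replaces the cardinality by quantifiers over list elements, to which
  \<open>polytime_Ball\<close> applies; \<open>krom_iff\<close> serves the same purpose.\<close>

lemma horn_iff: "horn R \<longleftrightarrow> (\<forall>C\<in>set R. \<forall>l\<in>set C. \<forall>m\<in>set C. \<not> (is_pos l \<and> is_pos m) \<or> l = m)"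
proof -
  have "card {v. Pos v \<in> set C} \<le> 1 \<longleftrightarrow>
      (\<forall>l\<in>set C. \<forall>m\<in>set C. \<not> (is_pos l \<and> is_pos m) \<or> l = m)" for C :: "'a literal list"
  proof -
    have "finite (Pos -` set C)"
      by (rule finite_vimageI) (auto simp: inj_def)
    then have "card {v. Pos v \<in> set C} \<le> 1 \<longleftrightarrow> (\<forall>u v. Pos u \<in> set C \<and> Pos v \<in> set C \<longrightarrow> u = v)"
      using card_le_Suc0_iff_eq[of "{v. Pos v \<in> set C}"] by (auto simp: vimage_def)
    also have "\<dots> \<longleftrightarrow> (\<forall>l\<in>set C. \<forall>m\<in>set C. \<not> (is_pos l \<and> is_pos m) \<or> l = m)"
      by (metis is_pos.simps literal.exhaust literal.inject(1))
    finally show ?thesis .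
  qed
  then show ?thesis by (simp add: horn_def)
qed

lemma krom_iff: "krom R \<longleftrightarrow>
    (\<forall>C\<in>set R. \<forall>k\<in>set C. \<forall>l\<in>set C. \<forall>m\<in>set C. k = l \<or> k = m \<or> l = m)"
proof -
  have "card (set C) \<le> 2 \<longleftrightarrow> (\<forall>k\<in>set C. \<forall>l\<in>set C. \<forall>m\<in>set C. k = l \<or> k = m \<or> l = m)"
    (is "_ \<longleftrightarrow> ?r") for C :: "'a literal list"
  proof
    assume card: "card (set C) \<le> 2"
    show ?r
    proof (intro ballI, rule ccontr)
      fix k l m
      assume "k \<in> set C" "l \<in> set C" "m \<in> set C" "\<not> (k = l \<or> k = m \<or> l = m)"
      then have "{k, l, m} \<subseteq> set C" "card {k, l, m} = 3" by auto
      then show False using card_mono[of "set C" "{k, l, m}"] card by simp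
    qed
  next
    assume r: ?r
    show "card (set C) \<le> 2"
    proof (rule ccontr)
      assume "\<not> ?thesis"
      then obtain T where "T \<subseteq> set C" "card T = 3"
        using obtain_subset_with_card_n[of 3 "set C"] by force
      then show False using r unfolding card_3_iff by blast
    qed
  qed
  then show ?thesis by (simp add: krom_def)
qed

section \<open>The decision procedure\<close>

text \<open>\<open>b\<close> and \<open>c\<close> are the two bits of a token. Seen from the end, a
  semicolon opens a list, a comma opens a word, and a bit is prepended to the current word; the sign
  thus becomes the first bit of its word.\<close>

definition token_step :: "bool \<Rightarrow> bool \<Rightarrow> bool list list list \<Rightarrow> bool list list list" where
  "token_step b c S =
     (if b then (if c then [] # S else case S of [] \<Rightarrow> [] | C # S' \<Rightarrow> ([] # C) # S')
      else case S of [] \<Rightarrow> [] | C # S' \<Rightarrow> (case C of [] \<Rightarrow> [] | w # C' \<Rightarrow> ((c # w) # C') # S'))"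

text \<open>The first component buffers the second bit of a token until its first bit, which is read
  later, arrives.\<close>

definition bit_step :: "bool \<Rightarrow> bool list \<times> bool list list list \<Rightarrow> bool list \<times> bool list list list" where
  "bit_step b s = (case fst s of [] \<Rightarrow> ([b], snd s) | c # _ \<Rightarrow> ([], token_step b c (snd s)))"

definition literal_of_word :: "bool list \<Rightarrow> var literal" where
  "literal_of_word w = (case w of [] \<Rightarrow> Pos [] | b # v \<Rightarrow> mk_lit b v)"

text \<open>Reading the input from its end, every list of the instance is built by prepending to it. The
  junk computed for words that encode no instance is harmless, as the decision procedure
  encodes the result again and compares.\<close>

definition decode :: "bool list \<Rightarrow> var literal list list" where
  "decode x = map (map literal_of_word) (snd (foldr bit_step x ([], [])))"

lemma decode_encode: "decode (encode K1 K2 R) = K1 # K2 # R"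
proof -
  define tok where "tok t = token_step (hd (token_bits t)) (last (token_bits t))" for t
  let ?w = "\<lambda>l :: var literal. is_pos l # lit_var l"
  have bits: "foldr bit_step (concat (map token_bits ts)) ([], S) = ([], foldr tok ts S)" for ts S
  proof (induction ts)
    case (Cons t ts)
    then show ?case by (cases t) (simp_all add: tok_def bit_step_def)
  qed simp
  have word: "foldr tok (map Bit v) ((w # C) # S) = ((v @ w) # C) # S" for v w C S
    by (induction v) (simp_all add: tok_def token_step_def)
  have "foldr tok (literal_tokens l) (C # S) = (?w l # C) # S" for l C S
    using word[of "lit_var l" "[]"] by (cases l) (simp_all add: tok_def token_step_def)
  then have "foldr tok (concat (map literal_tokens ls)) ([] # S) = map ?w ls # S" for ls S
    by (induction ls) simp_all
  then have "foldr tok (literals_tokens ls) S = map ?w ls # S" for ls S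
    by (simp add: literals_tokens_def) (simp add: tok_def token_step_def)
  then have tokens: "foldr tok (concat (map literals_tokens F)) [] = map (map ?w) F" for F
    by (induction F) simp_all
  have "literal_of_word (?w l) = l" for l
    by (cases l) (simp_all add: literal_of_word_def mk_lit_def)
  then show ?thesis
    unfolding decode_def encode_def bits snd_conv tokens by (simp add: o_def)
qed

lemmas polytime_list_rules = polytime_rules polytime_Ball polytime_Bex polytime_filter polytime_map
  polytime_append polytime_concat polytime_is_pos polytime_lit_var polytime_mk_lit polytime_compl
  polytime_eq_word polytime_eq_literal polytime_member

lemma polytime_bit_step: "polytime (\<lambda>y. bit_step (fst y) (snd y))"
  unfolding bit_step_def token_step_def by (intro polytime_rules)

lemma polytime_decode: "polytime decode"
proof -
  have "polytime (\<lambda>x :: bool list. foldr bit_step x ([], []))"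
  proof (rule polytime_foldr[where q = "[:9:]"])
    show "tsize (bit_step b s) \<le> tsize s + poly [:9:] (tsize x)" for b s and x :: "bool list"
      by (cases s) (auto simp: bit_step_def token_step_def to_tree_bool_def split: list.split)
  qed (intro polytime_rules polytime_comp2[OF polytime_bit_step])+
  then have "polytime (\<lambda>x. map (map literal_of_word) (snd (foldr bit_step x ([], []))))"
    unfolding literal_of_word_def
    by (intro polytime_list_rules) (auto intro: polytime_snd_comp)
  then show ?thesis by (simp add: decode_def[abs_def])
qed

text \<open>Eliminates the tokens, which have no tree encoding, and leaves only list operations on
  Booleans covered by the closure rules.\<close>

lemma encode_alt: "encode K1 K2 R = concat (map (\<lambda>ls. concat (map (\<lambda>l.
    False # is_pos l # concat (map (\<lambda>b. [False, b]) (lit_var l)) @ [True, False]) ls) @ [True, True])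
    (K1 # K2 # R))"
proof -
  have "concat (map token_bits (literal_tokens l)) =
      False # is_pos l # concat (map (\<lambda>b. [False, b]) (lit_var l)) @ [True, False]" for l
    by (cases l) (simp_all add: o_def)
  then have "concat (map token_bits (concat (map literal_tokens ls))) = concat (map (\<lambda>l.
      False # is_pos l # concat (map (\<lambda>b. [False, b]) (lit_var l)) @ [True, False]) ls)" for ls
    by (induction ls) simp_all
  then have "concat (map token_bits (literals_tokens ls)) = concat (map (\<lambda>l.
      False # is_pos l # concat (map (\<lambda>b. [False, b]) (lit_var l)) @ [True, False]) ls) @ [True, True]" for ls
    by (simp add: literals_tokens_def)
  then have "concat (map token_bits (concat (map literals_tokens F))) = concat (map (\<lambda>ls. concat (map (\<lambda>l.
      False # is_pos l # concat (map (\<lambda>b. [False, b]) (lit_var l)) @ [True, False]) ls) @ [True, True]) F)" for F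
    by (induction F) simp_all
  then show ?thesis unfolding encode_def .
qed

lemma polytime_encode: "polytime (\<lambda>p. encode (fst p) (fst (snd p)) (snd (snd p)))"
  unfolding encode_alt by (intro polytime_list_rules)

lemma polytime_consistent: "polytime (consistent :: var literal list \<Rightarrow> bool)"
  unfolding consistent_def[abs_def] by (intro polytime_list_rules)

lemma polytime_horn: "polytime (horn :: var cnf \<Rightarrow> bool)"
proof -
  have "polytime (\<lambda>R :: var cnf. \<forall>C\<in>set R. \<forall>l\<in>set C. \<forall>m\<in>set C. \<not> (is_pos l \<and> is_pos m) \<or> l = m)"
    by (intro polytime_list_rules)
  then show ?thesis by (rule polytime_retype) (simp only: horn_iff)
qed

lemma polytime_krom: "polytime (krom :: var cnf \<Rightarrow> bool)"
proof -
  have "polytime (\<lambda>R :: var cnf. \<forall>C\<in>set R. \<forall>k\<in>set C. \<forall>l\<in>set C. \<forall>m\<in>set C. k = l \<or> k = m \<or> l = m)"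
    by (intro polytime_list_rules)
  then show ?thesis by (rule polytime_retype) (simp only: krom_iff)
qed

lemma polytime_prevail: "polytime (\<lambda>p. prevail (fst p) (snd p :: var literal list))"
  unfolding prevail_def by (intro polytime_list_rules)

lemma polytime_undisputed: "polytime (\<lambda>p. undisputed (fst p) (snd p :: var literal list))"
  unfolding undisputed_def by (intro polytime_list_rules)

lemma polytime_propagate:
  "polytime (\<lambda>p. propagate (fst p) (fst (snd p)) (snd (snd p) :: var literal list))"
  unfolding propagate_def unit_derivable_def by (intro polytime_list_rules)

lemma tsize_filter: "tsize (filter P xs) \<le> tsize xs"
  by (induction xs) auto

lemma polytime_unit_closure: "polytime (\<lambda>p. unit_closure (fst p) (snd p :: var literal))"
proof -
  have lits: "polytime (\<lambda>p :: var cnf \<times> var literal. snd p # concat (fst p))"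
    by (intro polytime_list_rules)
  obtain q where q: "\<And>p :: var cnf \<times> var literal. tsize (snd p # concat (fst p)) \<le> poly q (tsize p)"
    using polytime_size[OF lits] by blast
  show ?thesis
    unfolding unit_closure_def
  proof (rule polytime_fold[OF lits, where q = q])
    show "tsize (propagate (fst p) (snd p # concat (fst p)) U) \<le> tsize U + poly q (tsize p)"
      for p :: "var cnf \<times> var literal" and U
      unfolding propagate_def by (rule trans_le_add2[OF order_trans[OF tsize_filter q]])
  qed (intro polytime_list_rules polytime_comp3[OF polytime_propagate])+
qed

lemma polytime_equivalent: "polytime (\<lambda>p. equivalent (fst p) (snd p :: var literal list))"
  unfolding equivalent_def clauses_follow_def refutes_def
  by (intro polytime_list_rules polytime_comp2[OF polytime_unit_closure])

section \<open>Correctness and running time of the whole procedure\<close>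

definition accepts :: "'v literal list \<Rightarrow> 'v literal list \<Rightarrow> 'v cnf \<Rightarrow> bool" where
  "accepts K1 K2 R \<longleftrightarrow> consistent K1 \<and> consistent K2 \<and> (horn R \<or> krom R) \<and>
     (equivalent R (prevail K1 K2) \<or> equivalent R (prevail K2 K1) \<or> equivalent R (undisputed K1 K2))"

lemma accepts_iff:
  "accepts K1 K2 R \<longleftrightarrow> models_conj K1 \<noteq> {} \<and> models_conj K2 \<noteq> {} \<and> models_cnf R \<noteq> {} \<and>
     (horn R \<or> krom R) \<and> obtainable K1 K2 R"
proof (cases "consistent K1 \<and> consistent K2 \<and> (horn R \<or> krom R)")
  case True
  then have K: "consistent K1" "consistent K2" and R: "horn R \<or> krom R" by auto
  note cons = consistent_prevail[OF K] consistent_prevail[OF K(2,1)] consistent_undisputed[of K1 K2]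
  have "accepts K1 K2 R \<longleftrightarrow> obtainable K1 K2 R"
    using True by (simp add: accepts_def obtainable_iff[OF K] equivalent_iff[OF R] cons)
  \<comment> \<open>An obtainable \<open>R\<close> shares its models with one of three consistent
    conjunctions, so it is satisfiable.\<close>
  moreover have "models_cnf R \<noteq> {}" if "obtainable K1 K2 R"
    using that cons unfolding obtainable_iff[OF K] consistent_iff[symmetric] by metis
  ultimately show ?thesis
    using True by (auto simp: consistent_iff)
next
  case False
  then show ?thesis by (auto simp: accepts_def consistent_iff)
qed

lemma polytime_accepts:
  "polytime (\<lambda>p. accepts (fst p) (fst (snd p)) (snd (snd p) :: var cnf))"
  unfolding accepts_def
  by (intro polytime_list_rules polytime_comp[OF _ polytime_consistent] polytime_comp[OF _ polytime_horn]
      polytime_comp[OF _ polytime_krom] polytime_comp2[OF polytime_equivalent]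
      polytime_comp2[OF polytime_prevail] polytime_comp2[OF polytime_undisputed])

definition decide :: "bool list \<Rightarrow> bool" where
  "decide x = (case decode x of [] \<Rightarrow> False | K1 # D \<Rightarrow>
     (case D of [] \<Rightarrow> False | K2 # R \<Rightarrow> encode K1 K2 R = x \<and> accepts K1 K2 R))"

lemma polytime_decide: "polytime decide"
  unfolding decide_def[abs_def]
  by (intro polytime_list_rules polytime_decode polytime_comp3[OF polytime_encode]
      polytime_comp3[OF polytime_accepts])

lemma decide_iff: "decide x \<longleftrightarrow> x \<in> obtainability_problem"
proof
  assume "decide x"
  then obtain K1 K2 R where "x = encode K1 K2 R" "accepts K1 K2 R"
    by (auto simp: decide_def split: list.splits)
  then show "x \<in> obtainability_problem"
    unfolding obtainability_problem_def accepts_iff by blast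
next
  assume "x \<in> obtainability_problem"
  then obtain K1 K2 R where "x = encode K1 K2 R" "accepts K1 K2 R"
    unfolding obtainability_problem_def accepts_iff by blast
  then show "decide x"
    by (simp add: decide_def decode_encode)
qed

theorem theorem4:
  shows "obtainability_problem \<in> class_P"
  using polytime_class_P[OF polytime_decide] by (simp add: decide_iff)

end
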